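(* Let $N=(V,E,c)$ be a locally finite, connected network with $\inf_{v\in V}c(v)>0$, and let $X=(X_n)_{n\geq0}$ be a random walk on $N$. If there exists $r>3/2$ such that \[ \liminf_{n\to\infty}\frac{d(X_0,X_n)}{n^{1/2}(\log n)^r}>0 \quad\text{almost surely}, \] then $X$ has infinitely many cut times almost surely.
   Context: A network $N=(V,E,c)$ consists of a graph $(V,E)$ with conductances $c:E\to(0,\infty)$. For $u\in V$, $c(u)$ is the total conductance of all oriented edges emanating from $u$, and $c(u,v)$ is the total conductance of oriented edges from $u$ to $v$; the random walk on $N$ is the Markov chain with transition probabilities $P(u,v)=c(u,v)/c(u)$. $d$ denotes the graph distance in $(V,E)$. A cut time of a sequence $(x_n)_{n\geq 0}$ is an integer $n\geq 0$ such that $\{x_i:i\leq n\}$ and $\{x_i:i>n\}$ are disjoint. *)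

theory Defs
  imports "HOL-Probability.Probability"
begin

text \<open>A network on the vertex type 'v: c u v is the total conductance of the
oriented edges from u to v (0 if there is no edge); c u v > 0 iff u and v are adjacent.\<close>

definition adj_rel :: "('v \<Rightarrow> 'v \<Rightarrow> real) \<Rightarrow> ('v \<times> 'v) set" where
  "adj_rel c = {(u, v). c u v > 0}"

definition network :: "('v \<Rightarrow> 'v \<Rightarrow> real) \<Rightarrow> bool" where
  "network c \<longleftrightarrow> (\<forall>u v. c u v \<ge> 0) \<and> (\<forall>u v. c u v = c v u)"

definition locally_finite :: "('v \<Rightarrow> 'v \<Rightarrow> real) \<Rightarrow> bool" where
  "locally_finite c \<longleftrightarrow> (\<forall>u. finite {v. c u v > 0})"

definition connected_net :: "('v \<Rightarrow> 'v \<Rightarrow> real) \<Rightarrow> bool" where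
  "connected_net c \<longleftrightarrow> (\<forall>u v. (u, v) \<in> (adj_rel c)\<^sup>*)"

text \<open>c(u): total conductance of oriented edges emanating from u.\<close>
definition cond_tot :: "('v \<Rightarrow> 'v \<Rightarrow> real) \<Rightarrow> 'v \<Rightarrow> real" where
  "cond_tot c u = (\<Sum>v\<in>{v. c u v > 0}. c u v)"

text \<open>Transition probabilities P(u,v) = c(u,v)/c(u).\<close>
definition trans_prob :: "('v \<Rightarrow> 'v \<Rightarrow> real) \<Rightarrow> 'v \<Rightarrow> 'v \<Rightarrow> real" where
  "trans_prob c u v = c u v / cond_tot c u"

text \<open>Graph distance.\<close>
definition graph_dist :: "('v \<Rightarrow> 'v \<Rightarrow> real) \<Rightarrow> 'v \<Rightarrow> 'v \<Rightarrow> nat" where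
  "graph_dist c u v = (LEAST n. (u, v) \<in> adj_rel c ^^ n)"

text \<open>X is a random walk on the network (arbitrary initial distribution):
Markov chain with transition probabilities trans_prob c.\<close>
definition random_walk :: "'a measure \<Rightarrow> ('v \<Rightarrow> 'v \<Rightarrow> real) \<Rightarrow> (nat \<Rightarrow> 'a \<Rightarrow> 'v) \<Rightarrow> bool" where
  "random_walk M c X \<longleftrightarrow> prob_space M \<and>
     (\<forall>n. X n \<in> measurable M (count_space UNIV)) \<and>
     (\<forall>n (xs :: nat \<Rightarrow> 'v).
        measure M {\<omega> \<in> space M. \<forall>i\<le>Suc n. X i \<omega> = xs i}
        = measure M {\<omega> \<in> space M. \<forall>i\<le>n. X i \<omega> = xs i} * trans_prob c (xs n) (xs (Suc n)))"

text \<open>Cut time of a sequence.\<close>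
definition cut_time :: "(nat \<Rightarrow> 'v) \<Rightarrow> nat \<Rightarrow> bool" where
  "cut_time x n \<longleftrightarrow> x ` {..n} \<inter> x ` {n<..} = {}"

end

theory Submission
  imports Defs
begin

text \<open>Kill the walk at \<open>x\<close> at a rate of order \<open>1 / d(o, x)\<^sup>2\<close>. Superdiffusive escape makes the total
  killing rate along the path summable, while an energy estimate shows that the probability \<open>h x\<close> that the
  killed walk from \<open>x\<close> hits \<open>o\<close> is at most a constant over \<open>d(o, x)\<close>. Hence \<open>- ln (h (X n))\<close> is eventually
  at least \<open>ln n / 4\<close>, and \<open>h\<close> is a supermartingale for the killed walk, so a walk that has just
  jumped from above the level \<open>a\<close> to \<open>(1 - t) a\<close> never returns above \<open>a\<close> with probability at least \<open>t\<close>. Up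
  to time \<open>N\<close> the running minimum of \<open>h\<close> has to gain \<open>K = ln N / 4\<close> on the logarithmic scale, and only a bounded
  part of this gain can come from jumps with \<open>t < 1/N\<close>. An optional stopping argument with a reward of
  \<open>L = 2 + 3 K + ln N\<close> for a level that is never crossed back shows that such a level exists with probability
  about \<open>K / L\<close>, which is bounded below, whatever the past; crossing it for the only time is a cut time.\<close>

section \<open>Truncated logarithms and the loss estimate\<close>

text \<open>Logarithmic depth of a running minimum \<open>m\<close>. Depth below
  \<open>exp (- K)\<close> is not charged, so the total loss along a path lies between 0 and
  \<open>K\<close>.\<close>

definition capped_log :: "real \<Rightarrow> real \<Rightarrow> real" where
  "capped_log K m = min (- ln m) K"

text \<open>Bounds the expected loss of \<open>capped_log\<close> over the period in which a level is active, where \<open>q\<close> is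
  the probability that the level is never given up and the current minimum is \<open>1 - s\<close> times the level:
  if the level is given up, a further depth \<open>\<sigma>\<close> was reached with probability at most \<open>q / \<sigma>\<close>, which
  integrates to \<open>- q ln s\<close>.\<close>

definition loss_bound :: "real \<Rightarrow> real \<Rightarrow> real \<Rightarrow> real" where
  "loss_bound K q s = (1 - q) * capped_log K (1 - s) + q * (K - ln s)"

lemma capped_log_mult:
  assumes "0 < a" "a \<le> 1" "0 < t" "t \<le> 1" "0 \<le> K"
  shows "capped_log K (a * t) \<le> capped_log K a + capped_log K t"
proof -
  have "ln a \<le> 0" "ln t \<le> 0" "ln (a * t) = ln a + ln t"
    using assms by (auto simp: ln_mult)
  then show ?thesis
    using assms unfolding capped_log_def by linarith
qed

lemma capped_log_bounds:
  assumes "0 < a" "a \<le> 1" "0 \<le> K"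
  shows "0 \<le> capped_log K a" "capped_log K a \<le> K" "capped_log K a \<le> - ln a"
  using assms by (auto simp: capped_log_def)

text \<open>When \<open>s\<close> grows by t, the first term rises by at most (1 - q) t / (1 - s')
  and the second falls by at least q t / s'. As s' <= q, the rise is at most t and the fall at least
  t.\<close>

lemma loss_bound_antimono:
  assumes "0 < s" "s \<le> s'" "s' < 1" "s' \<le> q" "q \<le> 1" "0 \<le> K"
  shows "loss_bound K q s' \<le> loss_bound K q s"
proof -
  define t where "t = s' - s"
  have t: "0 \<le> t" using assms by (simp add: t_def)
  have "capped_log K (1 - s') - capped_log K (1 - s) \<le> ln (1 - s) - ln (1 - s')"
  proof -
    have "ln (1 - s') \<le> ln (1 - s)"
      using assms by (subst ln_le_cancel_iff) auto
    then show ?thesis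
      unfolding capped_log_def by linarith
  qed
  also have "\<dots> = ln ((1 - s) / (1 - s'))"
    using assms by (simp add: ln_div)
  also have "\<dots> \<le> (1 - s) / (1 - s') - 1"
    using assms by (intro ln_le_minus_one) auto
  also have "\<dots> = t / (1 - s')"
    using assms by (simp add: field_simps t_def)
  finally have "(1 - q) * (capped_log K (1 - s') - capped_log K (1 - s)) \<le> (1 - q) * (t / (1 - s'))"
    using assms by (intro mult_left_mono) auto
  also have "\<dots> \<le> (1 - s') * (t / (1 - s'))"
    using assms t by (intro mult_right_mono) auto
  also have "\<dots> = s' * (t / s')"
    using assms by simp
  also have "\<dots> \<le> q * (t / s')"
    using assms t by (intro mult_right_mono) auto
  also have "\<dots> \<le> q * (ln s' - ln s)"
  proof (intro mult_left_mono)
    have "ln (s / s') \<le> s / s' - 1"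
      using assms by (intro ln_le_minus_one) auto
    then show "t / s' \<le> ln s' - ln s"
      using assms by (simp add: ln_div field_simps t_def)
  qed (use assms in auto)
  finally show ?thesis
    by (simp add: loss_bound_def algebra_simps)
qed

text \<open>Explains the size of the reward: a freshly opened level succeeds with probability
  \<open>q\<close> at least \<open>s\<close>, and a reward of this size pays for the expected loss.
  The two terms contribute at most (2 + 2 K) q and (K - ln s0) q.\<close>

lemma loss_bound_le:
  assumes "0 < s0" "s0 \<le> s" "s \<le> q" "q \<le> 1" "s < 1" "0 \<le> K"
  shows "loss_bound K q s \<le> (2 + 3 * K - ln s0) * q"
proof -
  \<comment> \<open>Up to s = 1/2, - ln (1 - s) is at most 2 s; beyond that the truncation gives K
    <= 2 K s.\<close>
  have "capped_log K (1 - s) \<le> 2 * s + 2 * K * s"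
  proof (cases "s \<le> 1/2")
    case True
    have "ln (1 / (1 - s)) \<le> 1 / (1 - s) - 1"
      using assms by (intro ln_le_minus_one) auto
    also have "\<dots> = s / (1 - s)"
      using assms by (simp add: field_simps)
    also have "\<dots> \<le> s / (1/2)"
      using assms True by (intro divide_left_mono) auto
    finally have "- ln (1 - s) \<le> 2 * s"
      using assms by (simp add: ln_div)
    then show ?thesis
      using assms mult_nonneg_nonneg[of K s] unfolding capped_log_def by linarith
  next
    case False
    then have "K \<le> 2 * s * K"
      using assms mult_right_mono[of 1 "2 * s" K] by simp
    then show ?thesis
      using assms unfolding capped_log_def by (simp add: mult.commute mult.left_commute min_le_iff_disj)
  qed
  also have "\<dots> \<le> (2 + 2 * K) * q"
    using assms mult_left_mono[of s q "2 + 2 * K"] by (simp add: algebra_simps)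
  finally have "capped_log K (1 - s) \<le> (2 + 2 * K) * q" .
  moreover have "(1 - q) * capped_log K (1 - s) \<le> capped_log K (1 - s)"
    using assms capped_log_bounds(1)[of "1 - s" K] by (intro mult_left_le_one_le) auto
  moreover have "q * (K - ln s) \<le> q * (K - ln s0)"
    using assms by (intro mult_left_mono) auto
  ultimately show ?thesis
    by (simp add: loss_bound_def algebra_simps)
qed

section \<open>Killed chains with an excessive function\<close>

text \<open>\<open>h\<close> is excessive for the killed chain with steps p x y / (1 + eps x). As a
  sum over an infinite set is 0, \<open>sum_p\<close> also makes \<open>nb x\<close> finite.\<close>

locale killed_chain =
  fixes nb :: "'v \<Rightarrow> 'v set" and p :: "'v \<Rightarrow> 'v \<Rightarrow> real" and eps h :: "'v \<Rightarrow> real"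
  assumes p_nonneg: "0 \<le> p x y"
    and sum_p: "(\<Sum>y\<in>nb x. p x y) = 1"
    and eps_nonneg: "0 \<le> eps x"
    and h_pos: "0 < h x"
    and h_le_1: "h x \<le> 1"
    and h_excessive: "(\<Sum>y\<in>nb x. p x y * h y) \<le> (1 + eps x) * h x"
begin

text \<open>Expectation for the chain without killing; the list holds the states after
  \<open>x\<close>. Killing is put into the functional, as in \<open>reward\<close> below.\<close>

primrec expect :: "nat \<Rightarrow> 'v \<Rightarrow> ('v list \<Rightarrow> real) \<Rightarrow> real" where
  "expect 0 x F = F []"
| "expect (Suc n) x F = (\<Sum>y\<in>nb x. p x y * expect n y (\<lambda>ys. F (y # ys)))"

lemma expect_affine: "expect n x (\<lambda>ys. (F ys + b) / d) = (expect n x F + b) / d"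
proof (induction n arbitrary: x F)
  case (Suc n)
  have "expect (Suc n) x (\<lambda>ys. (F ys + b) / d)
      = (\<Sum>y\<in>nb x. (p x y * expect n y (\<lambda>ys. F (y # ys)) + p x y * b) / d)"
    unfolding expect.simps Suc by (simp add: distrib_left)
  also have "\<dots> = (expect (Suc n) x F + b) / d"
    by (simp add: sum.distrib sum_p flip: sum_divide_distrib sum_distrib_right)
  finally show ?case .
qed simp

lemma abs_expect_le:
  assumes "\<And>ys. \<bar>F ys\<bar> \<le> B"
  shows "\<bar>expect n x F\<bar> \<le> B"
  using assms
proof (induction n arbitrary: x F)
  case (Suc n)
  have "\<bar>expect (Suc n) x F\<bar> \<le> (\<Sum>y\<in>nb x. \<bar>p x y * expect n y (\<lambda>ys. F (y # ys))\<bar>)"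
    unfolding expect.simps by (rule sum_abs)
  also have "\<dots> \<le> (\<Sum>y\<in>nb x. p x y * B)"
    using Suc by (intro sum_mono) (auto simp: abs_mult p_nonneg intro!: mult_left_mono)
  also have "\<dots> = B" by (simp add: sum_p flip: sum_distrib_right)
  finally show ?case .
qed auto

text \<open>The chain is killed at \<open>x\<close> with probability \<open>eps x / (1 + eps x)\<close>; being killed counts as
  staying below the level \<open>a\<close>.\<close>

primrec stay :: "nat \<Rightarrow> real \<Rightarrow> 'v \<Rightarrow> real" where
  "stay 0 a x = 1"
| "stay (Suc n) a x = ((\<Sum>y\<in>nb x. p x y * (if h y < a then stay n a y else 0)) + eps x) / (1 + eps x)"

lemma stay_le_1: "stay n a x \<le> 1"
proof (induction n arbitrary: x)
  case (Suc n)
  have "(\<Sum>y\<in>nb x. p x y * (if h y < a then stay n a y else 0)) \<le> (\<Sum>y\<in>nb x. p x y * 1)"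
    by (intro sum_mono mult_left_mono p_nonneg) (auto simp: Suc)
  then show ?case
    using eps_nonneg[of x] by (simp add: sum_p divide_simps)
qed simp

text \<open>Maximal inequality for the killed supermartingale \<open>h\<close>: the level
  \<open>a\<close> is reached with probability at most h x / a. In the induction a step to
  \<open>a\<close> or above loses nothing, because there 1 - h y / a <= 0.\<close>

lemma stay_ge:
  assumes "0 < a"
  shows "1 - h x / a \<le> stay n a x"
proof (induction n arbitrary: x)
  case 0
  then show ?case using h_pos[of x] assms by simp
next
  case (Suc n)
  have e: "0 < 1 + eps x" using eps_nonneg[of x] by simp
  have "1 - ((1 + eps x) * h x) / a \<le> 1 - (\<Sum>y\<in>nb x. p x y * h y) / a"
    using h_excessive[of x] assms by (simp add: divide_right_mono)
  also have "\<dots> = (\<Sum>y\<in>nb x. p x y * (1 - h y / a))"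
    by (simp add: right_diff_distrib sum_subtractf sum_p sum_divide_distrib)
  also have "\<dots> \<le> (\<Sum>y\<in>nb x. p x y * (if h y < a then stay n a y else 0))"
    using assms by (intro sum_mono mult_left_mono p_nonneg) (auto simp: Suc)
  finally have "(1 + eps x) * (1 - h x / a) \<le> (\<Sum>y\<in>nb x. p x y * (if h y < a then stay n a y else 0)) + eps x"
    by (simp add: algebra_simps)
  then show ?case
    using e by (simp add: pos_le_divide_eq mult.commute)
qed

end

section \<open>Optional stopping with a reward for levels that are never crossed back\<close>

text \<open>\<open>m\<close> is the running minimum of \<open>h\<close> along the path. Whenever it drops by a factor below
  \<open>1 - s0\<close> while no level is active, its old value becomes the active level; the level is given up
  as soon as the path returns to it. A level that is still active at the end separates the past
  before its activation from the future after it.\<close>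

locale level_search = killed_chain +
  fixes K s0 :: real
  assumes K_nonneg: "0 \<le> K" and s0_pos: "0 < s0" and s0_less_1: "s0 < 1"
begin

definition L :: real where "L = 2 + 3 * K - ln s0"

text \<open>No level at or below \<open>exp (- K)\<close> is opened, because in the application the
  far future is only known to stay at or below that height. A drop past (1 - s0) m ensures by
  \<open>stay_ge\<close> a chance of at least \<open>s0\<close> to stay below \<open>m\<close>. The
  step that gives a level up opens no new one.\<close>

primrec next_level :: "real option \<Rightarrow> real \<Rightarrow> 'a \<Rightarrow> real option" where
  "next_level None m y = (if exp (- K) < m \<and> h y < (1 - s0) * m then Some m else None)"
| "next_level (Some a) m y = (if h y < a then Some a else None)"

primrec success :: "real option \<Rightarrow> real \<Rightarrow> 'a list \<Rightarrow> bool" where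
  "success l m [] \<longleftrightarrow> l \<noteq> None"
| "success l m (y # ys) \<longleftrightarrow> success (next_level l m y) (min m (h y)) ys"

text \<open>Probability of not being killed along the given path; the last state is not
  charged.\<close>

primrec survival :: "'a \<Rightarrow> 'a list \<Rightarrow> real" where
  "survival x [] = 1"
| "survival x (y # ys) = survival y ys / (1 + eps x)"

text \<open>Expected payoff of the killed chain given its path. At the end an active level earns
  \<open>L\<close> and the depth is charged; being killed earns L - K, like a success at full
  depth.\<close>

primrec reward :: "real option \<Rightarrow> real \<Rightarrow> 'a \<Rightarrow> 'a list \<Rightarrow> real" where
  "reward l m x [] = (if l = None then 0 else L) - capped_log K m"
| "reward l m x (y # ys) = (reward (next_level l m y) (min m (h y)) y ys + eps x * (L - K)) / (1 + eps x)"

lemma expect_reward_Suc: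
  "expect (Suc n) x (reward l m x) =
   ((\<Sum>y\<in>nb x. p x y * expect n y (reward (next_level l m y) (min m (h y)) y)) + eps x * (L - K)) / (1 + eps x)"
proof -
  have "expect (Suc n) x (reward l m x) =
    (\<Sum>y\<in>nb x. (p x y * expect n y (reward (next_level l m y) (min m (h y)) y) + p x y * (eps x * (L - K))) / (1 + eps x))"
    unfolding expect.simps reward.simps expect_affine by (simp add: distrib_left)
  also have "\<dots> = ((\<Sum>y\<in>nb x. p x y * expect n y (reward (next_level l m y) (min m (h y)) y)) + eps x * (L - K)) / (1 + eps x)"
    by (simp add: sum.distrib sum_p flip: sum_divide_distrib sum_distrib_right)
  finally show ?thesis .
qed

lemma L_ge: "K \<le> L"
  using K_nonneg s0_pos s0_less_1 ln_less_zero[of s0] unfolding L_def by linarith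

text \<open>For an active level the bound is affine in \<open>stay n a x\<close>, hence preserved by averaging over a
  step, with being killed in the role of \<open>stay = 1\<close>.\<close>

lemma expect_reward_ge_aux:
  "(\<forall>x m. 0 < m \<longrightarrow> m \<le> h x \<longrightarrow> - capped_log K m + real n * ln (1 - s0) \<le> expect n x (reward None m x)) \<and>
   (\<forall>x m a. 0 < m \<longrightarrow> m \<le> h x \<longrightarrow> h x < a \<longrightarrow> a \<le> 1 \<longrightarrow>
      - capped_log K a + real n * ln (1 - s0) + L * stay n a x - loss_bound K (stay n a x) (1 - m / a)
       \<le> expect n x (reward (Some a) m x))"
proof (induction n)
  case 0
  have "- capped_log K a + L - loss_bound K 1 (1 - m / a) \<le> L - capped_log K m"
    if "0 < m" "m \<le> h x" "h x < a" "a \<le> 1" for x m a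
  proof -
    have "capped_log K m = capped_log K (a * (m / a))"
      using that by simp
    also have "\<dots> \<le> capped_log K a + capped_log K (m / a)"
      using that K_nonneg by (intro capped_log_mult) auto
    finally have "capped_log K m \<le> capped_log K a + capped_log K (m / a)" .
    moreover have "capped_log K (m / a) \<le> K"
      by (simp add: capped_log_def)
    moreover have "K \<le> loss_bound K 1 (1 - m / a)"
      using that by (simp add: loss_bound_def)
    ultimately show ?thesis by linarith
  qed
  then show ?case by auto
next
  case (Suc n)
  define \<eta> where "\<eta> = - ln (1 - s0)"
  have \<eta>: "0 \<le> \<eta>" using s0_pos s0_less_1 by (simp add: \<eta>_def)
  have IH1: "- capped_log K m - real n * \<eta> \<le> expect n x (reward None m x)"
    if "0 < m" "m \<le> h x" for x m
    using Suc.IH that by (auto simp: \<eta>_def)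
  have IH2: "- capped_log K a - real n * \<eta> + L * stay n a x - loss_bound K (stay n a x) (1 - m / a)
       \<le> expect n x (reward (Some a) m x)"
    if "0 < m" "m \<le> h x" "h x < a" "a \<le> 1" for x m a
    using Suc.IH that by (auto simp: \<eta>_def)
  have idle: "- capped_log K m - real (Suc n) * \<eta> \<le> expect (Suc n) x (reward None m x)"
    if m: "0 < m" "m \<le> h x" for m x
  proof -
    define B where "B = - capped_log K m - real (Suc n) * \<eta>"
    have m1: "m \<le> 1" using m h_le_1[of x] by simp
    have B: "B \<le> L - K"
      using L_ge capped_log_bounds(1)[OF m(1) m1 K_nonneg] mult_nonneg_nonneg[OF of_nat_0_le_iff \<eta>, of "Suc n"]
      unfolding B_def by linarith
    have each: "B \<le> expect n y (reward (next_level None m y) (min m (h y)) y)" for y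
    proof -
      \<comment> \<open>Either the drop opens a level, or the depth is already saturated at
        \<open>K\<close>, or the drop costs at most \<open>\<eta>\<close>.\<close>
      consider "exp (- K) < m" "h y < (1 - s0) * m" | "m \<le> exp (- K)" | "(1 - s0) * m \<le> h y" by linarith
      then show ?thesis
      proof cases
        case 1
        have hm: "h y < m"
          using 1(2) mult_pos_pos[OF s0_pos m(1)] unfolding left_diff_distrib by linarith
        define q where "q = stay n m y"
        define s where "s = 1 - h y / m"
        have s: "s0 \<le> s" "s \<le> q" "s < 1" "q \<le> 1"
          using 1(2) m h_pos[of y] stay_ge[OF m(1), of y n] stay_le_1
          by (auto simp: s_def q_def field_simps)
        \<comment> \<open>The choice of \<open>L\<close> makes opening a level no loss.\<close>
        have "0 \<le> L * q - loss_bound K q s"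
          using loss_bound_le[OF s0_pos s(1,2,4,3) K_nonneg] by (simp add: L_def)
        moreover have "- capped_log K m - real n * \<eta> + L * q - loss_bound K q s
            \<le> expect n y (reward (Some m) (h y) y)"
          using IH2[of "h y" y m] h_pos hm m1 by (simp add: q_def s_def)
        ultimately show ?thesis
          using 1 hm \<eta> by (simp add: B_def min_def algebra_simps)
      next
        case 2
        have mm: "0 < min m (h y)" using m h_pos[of y] by simp
        have "K \<le> - ln m"
          using ln_mono[OF 2 m(1)] by simp
        then have "capped_log K (min m (h y)) \<le> capped_log K m"
          by (simp add: capped_log_def)
        then show ?thesis
          using IH1[OF mm, of y] 2 \<eta> by (simp add: B_def algebra_simps)
      next
        case 3
        have mm: "0 < min m (h y)" using m h_pos[of y] by simp
        have "(1 - s0) * m \<le> min m (h y)"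
          using 3 m s0_pos s0_less_1 by (auto simp: min_def mult_left_le_one_le)
        then have "ln (1 - s0) + ln m \<le> ln (min m (h y))"
          using m s0_less_1 ln_mono[of "(1 - s0) * m" "min m (h y)"] by (simp add: ln_mult_pos)
        then have "capped_log K (min m (h y)) \<le> capped_log K m + \<eta>"
          using \<eta> unfolding capped_log_def \<eta>_def by linarith
        then show ?thesis
          using IH1[OF mm, of y] 3 \<eta> by (simp add: B_def algebra_simps)
      qed
    qed
    have e: "0 < 1 + eps x" using eps_nonneg[of x] by simp
    have "B * (1 + eps x) = (\<Sum>y\<in>nb x. p x y * B) + eps x * B"
      by (simp add: distrib_left sum_p mult.commute[of B "eps x"] flip: sum_distrib_right)
    also have "\<dots> \<le> (\<Sum>y\<in>nb x. p x y * expect n y (reward (next_level None m y) (min m (h y)) y)) + eps x * (L - K)"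
      by (intro add_mono sum_mono mult_left_mono each B p_nonneg eps_nonneg)
    finally show ?thesis
      unfolding expect_reward_Suc using e by (simp add: B_def pos_le_divide_eq)
  qed
  have active: "- capped_log K a - real (Suc n) * \<eta> + L * stay (Suc n) a x
        - loss_bound K (stay (Suc n) a x) (1 - m / a) \<le> expect (Suc n) x (reward (Some a) m x)"
    if m: "0 < m" "m \<le> h x" "h x < a" "a \<le> 1" for m x a
  proof -
    define B where "B = - capped_log K a - real n * \<eta>"
    define s where "s = 1 - m / a"
    define q where "q y = (if h y < a then stay n a y else 0)" for y
    define D where "D = capped_log K (1 - s)"
    define C where "C = L + D - K + ln s"
    have a: "0 < a" using m h_pos[of x] by linarith
    have s: "0 < s" "s < 1" using m a by (auto simp: s_def)
    \<comment> \<open>Affine in \<open>t\<close>: the value is B - D at t = 0, when the level is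
      given up, and at most L - K at t = 1, which covers being killed.\<close>
    have lin: "B + L * t - loss_bound K t s = B - D + C * t" for t
      by (simp add: loss_bound_def C_def D_def algebra_simps)
    have each: "B - D + C * q y \<le> expect n y (reward (next_level (Some a) m y) (min m (h y)) y)" for y
    proof (cases "h y < a")
      case False
      then have "min m (h y) = m" using m by simp
      \<comment> \<open>When the level is given up, the depth of \<open>m\<close> splits into that
        of \<open>a\<close> and that of m / a = 1 - s.\<close>
      moreover have "capped_log K (a * (m / a)) \<le> capped_log K a + capped_log K (m / a)"
        using m a K_nonneg by (intro capped_log_mult) auto
      moreover have "- capped_log K m - real n * \<eta> \<le> expect n y (reward None m y)"
        using False m by (intro IH1) auto
      ultimately show ?thesis
        using False a by (simp add: q_def B_def D_def s_def)
    next
      case True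
      define m' where "m' = min m (h y)"
      have m': "0 < m'" "m' \<le> h y" "m' \<le> m" using m h_pos[of y] by (auto simp: m'_def)
      have "B + L * stay n a y - loss_bound K (stay n a y) (1 - m' / a) \<le> expect n y (reward (Some a) m' y)"
        using IH2[OF m'(1,2) True m(4)] by (simp add: B_def)
      \<comment> \<open>The minimum may drop while the level is active; the condition s' <= q of
        \<open>loss_bound_antimono\<close> is then \<open>stay_ge\<close> at
        \<open>y\<close>.\<close>
      moreover have "loss_bound K (stay n a y) (1 - m' / a) \<le> loss_bound K (stay n a y) s"
      proof (cases "m \<le> h y")
        case True
        then show ?thesis by (simp add: m'_def s_def)
      next
        case False
        then show ?thesis
          using s m' a stay_ge[OF a, of y n] stay_le_1[of n a y] K_nonneg
          by (intro loss_bound_antimono) (auto simp: s_def m'_def divide_right_mono)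
      qed
      ultimately show ?thesis
        using True lin[of "stay n a y"] by (simp add: q_def m'_def)
    qed
    have kill: "B - D + C \<le> L - K"
      using s capped_log_bounds(1)[OF a m(4) K_nonneg] mult_nonneg_nonneg[OF of_nat_0_le_iff \<eta>, of n]
        ln_less_zero[of s] unfolding C_def B_def by linarith
    have e: "0 < 1 + eps x" using eps_nonneg[of x] by simp
    have "(B - D + C * stay (Suc n) a x) * (1 + eps x)
        = (B - D) * (1 + eps x) + C * ((\<Sum>y\<in>nb x. p x y * q y) + eps x)"
      using e by (simp add: algebra_simps q_def) (simp add: field_simps)
    also have "\<dots> = (\<Sum>y\<in>nb x. p x y * (B - D + C * q y)) + eps x * (B - D + C)"
    proof -
      have "(\<Sum>y\<in>nb x. p x y * (B - D + C * q y)) = (\<Sum>y\<in>nb x. p x y * (B - D)) + (\<Sum>y\<in>nb x. C * (p x y * q y))"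
        by (subst sum.distrib[symmetric], rule sum.cong) (auto simp: algebra_simps)
      also have "\<dots> = (B - D) + C * (\<Sum>y\<in>nb x. p x y * q y)"
        by (simp add: sum_p flip: sum_distrib_right sum_distrib_left)
      finally show ?thesis by (simp add: algebra_simps)
    qed
    also have "\<dots> \<le> (\<Sum>y\<in>nb x. p x y * expect n y (reward (next_level (Some a) m y) (min m (h y)) y)) + eps x * (L - K)"
      by (intro add_mono sum_mono mult_left_mono each kill p_nonneg eps_nonneg)
    finally have "B - D + C * stay (Suc n) a x \<le> expect (Suc n) x (reward (Some a) m x)"
      unfolding expect_reward_Suc using e by (simp add: pos_le_divide_eq)
    then show ?thesis
      using lin[of "stay (Suc n) a x"] \<eta> by (simp add: B_def s_def algebra_simps del: stay.simps expect.simps)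
  qed
  from idle active show ?case
    by (auto simp: \<eta>_def simp del: stay.simps expect.simps)
qed

lemma expect_reward_ge:
  assumes "0 < m" "m \<le> h x"
  shows "- capped_log K m + real n * ln (1 - s0) \<le> expect n x (reward None m x)"
  using expect_reward_ge_aux assms by blast

lemma survival_bounds: "0 < survival x ys" "survival x ys \<le> 1"
proof (induction ys arbitrary: x)
  case (Cons y ys)
  { case 1 show ?case using Cons eps_nonneg[of x] by (simp add: add_pos_nonneg) }
  { case 2 show ?case using Cons[of y] eps_nonneg[of x] by (simp add: divide_simps) }
qed auto

text \<open>Passes from the payoff to events of the unkilled path: \<open>L\<close> is earned by
  success or by being killed. The running minimum is at most the last value of \<open>h\<close>, so
  the full \<open>K\<close> is charged once that value is at most \<open>exp (- K)\<close>; being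
  killed always costs \<open>K\<close>.\<close>

lemma reward_le:
  assumes "0 < m" "m \<le> h x"
  shows "reward l m x ys \<le> L * (if success l m ys then 1 else 1 - survival x ys)
           - (if h (last (x # ys)) \<le> exp (- K) then K else 0)"
  using assms
proof (induction ys arbitrary: l m x)
  case Nil
  have "0 \<le> capped_log K m"
    using Nil h_le_1[of x] K_nonneg by (intro capped_log_bounds) auto
  moreover have "K \<le> capped_log K m" if "h x \<le> exp (- K)"
  proof -
    have "ln m \<le> ln (exp (-K))" using that Nil by (intro ln_mono) auto
    then show ?thesis by (simp add: capped_log_def)
  qed
  ultimately show ?case by auto
next
  case (Cons y ys)
  define l' where "l' = next_level l m y"
  define m' where "m' = min m (h y)"
  define Z where "Z = (if h (last (y # ys)) \<le> exp (- K) then K else 0)"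
  have Z: "Z \<le> K" using K_nonneg by (simp add: Z_def)
  have e: "0 < 1 + eps x" using eps_nonneg[of x] by simp
  have "reward l' m' y ys \<le> L * (if success l' m' ys then 1 else 1 - survival y ys) - Z"
    unfolding Z_def using Cons.prems h_pos[of y] by (intro Cons.IH) (auto simp: m'_def)
  then have "reward l m x (y # ys) \<le> (L * (if success l' m' ys then 1 else 1 - survival y ys) - Z + eps x * (L - Z)) / (1 + eps x)"
    using e Z eps_nonneg[of x] unfolding reward.simps l'_def m'_def
    by (intro divide_right_mono add_mono mult_left_mono) auto
  also have "\<dots> = L * (if success l m (y # ys) then 1 else 1 - survival x (y # ys)) - Z"
    using e by (simp add: l'_def m'_def divide_simps) (simp add: algebra_simps)
  finally show ?case by (simp add: Z_def)
qed

lemma abs_reward_le: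
  assumes "0 < m" "m \<le> 1"
  shows "\<bar>reward l m x ys\<bar> \<le> L"
  using assms
proof (induction ys arbitrary: l m x)
  case Nil
  then show ?case
    using capped_log_bounds[OF Nil K_nonneg] L_ge K_nonneg by auto
next
  case (Cons y ys)
  have "\<bar>reward (next_level l m y) (min m (h y)) y ys\<bar> \<le> L"
    using Cons.prems h_pos[of y] by (intro Cons.IH) auto
  then have "\<bar>reward (next_level l m y) (min m (h y)) y ys + eps x * (L - K)\<bar> \<le> L + eps x * L"
    using eps_nonneg[of x] L_ge K_nonneg mult_left_mono[of "L - K" L "eps x"]
      mult_nonneg_nonneg[of "eps x" "L - K"] by linarith
  also have "\<dots> = (1 + eps x) * L" by (simp add: algebra_simps)
  finally show ?case
    using eps_nonneg[of x] by (simp add: abs_divide pos_divide_le_eq mult.commute)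
qed

text \<open>Union bound over the killing times; \<open>butlast\<close> because the last state is not
  charged.\<close>

lemma survival_ge: "1 - survival x ys \<le> sum_list (map eps (butlast (x # ys)))"
proof (induction ys arbitrary: x)
  case (Cons y ys)
  have "1 - survival x (y # ys) = (1 - survival y ys + eps x) / (1 + eps x)"
    using eps_nonneg[of x] by (simp add: field_simps)
  also have "\<dots> \<le> (1 - survival y ys + eps x) / 1"
    using eps_nonneg[of x] survival_bounds[of y ys] by (intro divide_left_mono) auto
  also have "\<dots> \<le> sum_list (map eps (butlast (x # y # ys)))"
    using Cons[of y] by simp
  finally show ?case .
qed simp

text \<open>The level active at the end is the initial one or was opened by the step to the first
  state of \<open>vs\<close>, at the height of the running minimum; so it is at most
  \<open>m\<close> and at most every value of \<open>h\<close> on \<open>us\<close>.\<close>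

lemma success_imp_separated:
  assumes "success l m ys" "\<And>a. l = Some a \<Longrightarrow> exp (- K) < a"
  shows "(\<exists>a. l = Some a \<and> (\<forall>y\<in>set ys. h y < a)) \<or>
         (\<exists>us vs a. ys = us @ vs \<and> vs \<noteq> [] \<and> exp (- K) < a \<and> a \<le> m \<and>
            (\<forall>y\<in>set us. a \<le> h y) \<and> (\<forall>y\<in>set vs. h y < a))"
  using assms
proof (induction ys arbitrary: l m)
  case (Cons y ys)
  define l' where "l' = next_level l m y"
  have l': "exp (- K) < a" if "l' = Some a" for a
    using that Cons.prems by (cases l) (auto simp: l'_def split: if_splits)
  have s: "success l' (min m (h y)) ys" using Cons.prems by (simp add: l'_def)
  from Cons.IH[OF s l'] show ?case
  proof
    assume "\<exists>a. l' = Some a \<and> (\<forall>y\<in>set ys. h y < a)"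
    then obtain a where a: "l' = Some a" "\<forall>y\<in>set ys. h y < a" by auto
    show ?case
    proof (cases l)
      case None
      then have am: "a = m" "h y < (1 - s0) * m" "exp (- K) < m"
        using a(1) by (auto simp: l'_def split: if_splits)
      moreover have "0 < m"
        using am(3) exp_gt_zero[of "- K"] by linarith
      then have "h y < m"
        using am(2) mult_pos_pos[OF s0_pos \<open>0 < m\<close>] unfolding left_diff_distrib by linarith
      ultimately show ?thesis
        using a(2) by (intro disjI2 exI[of _ "[]"] exI[of _ "y # ys"] exI[of _ m]) auto
    next
      case (Some b)
      then show ?thesis using a by (auto simp: l'_def split: if_splits)
    qed
  next
    assume "\<exists>us vs a. ys = us @ vs \<and> vs \<noteq> [] \<and> exp (- K) < a \<and> a \<le> min m (h y) \<and>
            (\<forall>y\<in>set us. a \<le> h y) \<and> (\<forall>y\<in>set vs. h y < a)"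
    then obtain us vs a where "ys = us @ vs" "vs \<noteq> []" "exp (- K) < a" "a \<le> min m (h y)"
            "\<forall>y\<in>set us. a \<le> h y" "\<forall>y\<in>set vs. h y < a" by blast
    then show ?case by (intro disjI2 exI[of _ "y # us"] exI[of _ vs] exI[of _ a]) auto
  qed
qed auto

end

section \<open>Networks, the killing rate and decay of the hitting probability\<close>

locale conductance_network =
  fixes c :: "'v \<Rightarrow> 'v \<Rightarrow> real" and root :: 'v and \<delta> :: real
  assumes network: "network c" and locally_finite: "locally_finite c"
    and connected_net: "connected_net c"
    and \<delta>_pos: "0 < \<delta>" and cond_tot_ge: "\<delta> \<le> cond_tot c v"
begin

abbreviation nbrs :: "'v \<Rightarrow> 'v set" where "nbrs x \<equiv> {y. c x y > 0}"

lemma c_nonneg: "0 \<le> c x y" and c_sym: "c x y = c y x"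
  using network by (auto simp: network_def)

lemma finite_nbrs: "finite (nbrs x)"
  using locally_finite by (simp add: locally_finite_def)

lemma cond_tot_pos: "0 < cond_tot c x"
  using \<delta>_pos cond_tot_ge[of x] by linarith

lemma trans_prob_nonneg: "0 \<le> trans_prob c x y"
  using c_nonneg cond_tot_pos[of x] by (simp add: trans_prob_def)

lemma sum_trans_prob: "(\<Sum>y\<in>nbrs x. trans_prob c x y) = 1"
  using cond_tot_pos[of x] by (simp add: trans_prob_def flip: sum_divide_distrib) (simp add: cond_tot_def)

lemma graph_dist_relpow: "(x, y) \<in> adj_rel c ^^ graph_dist c x y"
proof -
  have "\<exists>n. (x, y) \<in> adj_rel c ^^ n"
    using connected_net by (simp add: connected_net_def rtrancl_power)
  then show ?thesis unfolding graph_dist_def by (rule LeastI_ex)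
qed

lemma graph_dist_le: "(x, y) \<in> adj_rel c ^^ n \<Longrightarrow> graph_dist c x y \<le> n"
  unfolding graph_dist_def by (rule Least_le)

lemma graph_dist_triangle: "graph_dist c x z \<le> graph_dist c x y + graph_dist c y z"
  by (intro graph_dist_le) (auto simp: relpow_add intro: graph_dist_relpow)

lemma graph_dist_nbr: "c x y > 0 \<Longrightarrow> graph_dist c x y \<le> 1"
  using graph_dist_le[of x y 1] by (simp add: adj_rel_def)

lemma finite_relpow_Image: "finite {y. (x, y) \<in> adj_rel c ^^ n}"
proof (induction n)
  case (Suc n)
  have "{y. (x, y) \<in> adj_rel c ^^ Suc n} = (\<Union>z\<in>{y. (x, y) \<in> adj_rel c ^^ n}. nbrs z)"
    by (auto simp: adj_rel_def)
  then show ?case using Suc finite_nbrs by simp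
qed simp

text \<open>Balls around \<open>root\<close> are finite and exhaust the graph. Countability makes
  the laws of finite paths discrete.\<close>

lemma countable_vertices: "countable (UNIV :: 'v set)"
proof -
  have "y \<in> (\<Union>n. {y. (root, y) \<in> adj_rel c ^^ n})" for y
    using graph_dist_relpow[of root y] by blast
  then have "UNIV = (\<Union>n. {y. (root, y) \<in> adj_rel c ^^ n})"
    by blast
  also have "countable \<dots>"
    by (auto intro: countable_finite finite_relpow_Image)
  finally show ?thesis .
qed

definition s :: "'v \<Rightarrow> real" where "s x = 1 + real (graph_dist c root x)"

text \<open>The constant 6 exceeds the 9/2 lost to the gradient of the weight in
  \<open>subsolution_decay\<close>; the 1 in \<open>s\<close> avoids a division by 0 at
  \<open>root\<close>.\<close>

definition kill_rate :: "'v \<Rightarrow> real" where "kill_rate x = 6 / (s x)\<^sup>2"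

lemma s_ge_1: "1 \<le> s x"
  by (simp add: s_def)

lemma s_root: "s root = 1"
  using graph_dist_le[of root root 0] by (simp add: s_def)

lemma s_nbr: "c x y > 0 \<Longrightarrow> s y \<le> s x + 1"
  using graph_dist_triangle[of root y x] graph_dist_nbr[of x y] by (simp add: s_def)

lemma kill_rate_pos: "0 < kill_rate x"
  using s_ge_1[of x] by (simp add: kill_rate_def)

text \<open>The distance changes by at most 1 along an edge, and s x + s y <= 2 s x + 1 <= 3 s
  x.\<close>

lemma s_square_diff:
  assumes "c x y > 0"
  shows "((s x)\<^sup>2 - (s y)\<^sup>2)\<^sup>2 \<le> 9 * (s x)\<^sup>2"
proof -
  have d: "\<bar>s x - s y\<bar> \<le> 1"
    using s_nbr[OF assms] s_nbr[of y x] assms c_sym[of x y] by auto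
  have "\<bar>(s x)\<^sup>2 - (s y)\<^sup>2\<bar> = \<bar>s x - s y\<bar> * (s x + s y)"
    using s_ge_1[of x] s_ge_1[of y] by (simp add: power2_eq_square square_diff_square_factored abs_mult)
  also have "\<dots> \<le> 1 * (3 * s x)"
    using d s_ge_1[of x] s_ge_1[of y] by (intro mult_mono) auto
  finally have "\<bar>(s x)\<^sup>2 - (s y)\<^sup>2\<bar>\<^sup>2 \<le> (3 * s x)\<^sup>2"
    by (intro power_mono) auto
  then show ?thesis by (simp add: power_mult_distrib)
qed

text \<open>Testing the subsolution inequality against \<open>s\<^sup>4 u\<close> and symmetrizing, the gradient of the
  weight costs at most \<open>9/2 s\<^sup>2 u\<^sup>2\<close> while the killing contributes \<open>6 s\<^sup>2 u\<^sup>2\<close>.\<close>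

lemma subsolution_decay:
  fixes u :: "'v \<Rightarrow> real"
  assumes fin: "finite {x. u x \<noteq> 0}" and nonneg: "\<And>x. 0 \<le> u x" and root: "u root = 1"
    and sub: "\<And>x. x \<noteq> root \<Longrightarrow> (1 + kill_rate x) * cond_tot c x * u x \<le> (\<Sum>y\<in>nbrs x. c x y * u y)"
  shows "u x \<le> sqrt (5 * cond_tot c root / \<delta>) / s x"
proof -
  define S where "S = {x. u x \<noteq> 0}"
  \<comment> \<open>With the neighbours added, the neighbour sums at points of \<open>S\<close> run
    over one finite set, and the double sum can be symmetrized.\<close>
  define T where "T = S \<union> (\<Union>x\<in>S. nbrs x)"
  define A where "A = (\<Sum>x\<in>S. cond_tot c x * (s x)\<^sup>2 * (u x)\<^sup>2)"
  define w where "w x = (s x)\<^sup>2" for x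
  have finT: "finite T" using fin finite_nbrs by (auto simp: T_def S_def)
  have ST: "S \<subseteq> T" by (auto simp: T_def)
  have sum_T: "(\<Sum>y\<in>T. c x y * f y) = (\<Sum>y\<in>nbrs x. c x y * f y)" if "x \<in> S" for x f
  proof (rule sum.mono_neutral_right[OF finT])
    show "nbrs x \<subseteq> T" using that by (auto simp: T_def)
    show "\<forall>y\<in>T - nbrs x. c x y * f y = 0"
      using c_nonneg[of x] by (auto simp: order.order_iff_strict)
  qed
  have rootS: "root \<in> S" using root by (simp add: S_def)
  \<comment> \<open>Only \<open>root\<close> may violate the subsolution inequality; there s = u = 1
    and the rate is 6, so its term is at most 1 + 6 times the conductance of
    \<open>root\<close>.\<close>
  have "(\<Sum>x\<in>S. (w x)\<^sup>2 * u x * ((1 + kill_rate x) * cond_tot c x * u x - (\<Sum>y\<in>T. c x y * u y)))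
      \<le> (\<Sum>x\<in>S. if x = root then 7 * cond_tot c root else 0)"
  proof (rule sum_mono)
    fix x assume x: "x \<in> S"
    show "(w x)\<^sup>2 * u x * ((1 + kill_rate x) * cond_tot c x * u x - (\<Sum>y\<in>T. c x y * u y))
      \<le> (if x = root then 7 * cond_tot c root else 0)"
    proof (cases "x = root")
      case True
      have "0 \<le> (\<Sum>y\<in>T. c root y * u y)" by (intro sum_nonneg mult_nonneg_nonneg c_nonneg nonneg)
      then show ?thesis using True by (simp add: root w_def s_root kill_rate_def)
    next
      case False
      then show ?thesis
        using sub[OF False] sum_T[OF x, of u] nonneg[of x] by (simp add: mult_nonneg_nonpos)
    qed
  qed
  also have "\<dots> = 7 * cond_tot c root"
    using rootS fin by (simp add: S_def)
  finally have upper: "(\<Sum>x\<in>S. (w x)\<^sup>2 * u x * ((1 + kill_rate x) * cond_tot c x * u x - (\<Sum>y\<in>T. c x y * u y)))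
      \<le> 7 * cond_tot c root" .
  \<comment> \<open>The last summand accounts for the gradient of the weight; with it, g x y + g y x
    is half of the sum of squares below.\<close>
  define g where "g x y = (w x)\<^sup>2 * (u x)\<^sup>2 - (w x)\<^sup>2 * u x * u y + (w x - w y)\<^sup>2 * (u x)\<^sup>2 / 2" for x y
  have "0 \<le> (\<Sum>x\<in>T. \<Sum>y\<in>T. c x y * (g x y + g y x))"
  proof (intro sum_nonneg mult_nonneg_nonneg c_nonneg)
    fix x y
    have "2 * (g x y + g y x) = 2 * (w x * u x - w y * u y)\<^sup>2 + (w x - w y)\<^sup>2 * (u x - u y)\<^sup>2"
      by (simp add: g_def power2_eq_square field_simps)
    also have "0 \<le> \<dots>" by simp
    finally show "0 \<le> g x y + g y x" by simp
  qed
  also have "\<dots> = (\<Sum>x\<in>T. \<Sum>y\<in>T. c x y * g x y) + (\<Sum>x\<in>T. \<Sum>y\<in>T. c y x * g y x)"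
    by (simp add: distrib_left sum.distrib c_sym)
  also have "(\<Sum>x\<in>T. \<Sum>y\<in>T. c y x * g y x) = (\<Sum>x\<in>T. \<Sum>y\<in>T. c x y * g x y)"
    by (rule sum.swap)
  finally have "0 \<le> (\<Sum>x\<in>T. \<Sum>y\<in>T. c x y * g x y)" by simp
  \<comment> \<open>The outer sum returns to \<open>S\<close> because every term of
    \<open>g x y\<close> has the factor \<open>u x\<close>.\<close>
  also have "\<dots> = (\<Sum>x\<in>S. \<Sum>y\<in>T. c x y * g x y)"
    by (rule sum.mono_neutral_right[OF finT ST]) (auto simp: S_def g_def)
  also have "\<dots> \<le> (\<Sum>x\<in>S. \<Sum>y\<in>T. c x y * ((w x)\<^sup>2 * (u x)\<^sup>2 - (w x)\<^sup>2 * u x * u y + 9/2 * (s x)\<^sup>2 * (u x)\<^sup>2))"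
  proof (intro sum_mono)
    fix x y
    show "c x y * g x y \<le> c x y * ((w x)\<^sup>2 * (u x)\<^sup>2 - (w x)\<^sup>2 * u x * u y + 9/2 * (s x)\<^sup>2 * (u x)\<^sup>2)"
    proof (cases "c x y > 0")
      case True
      have "(w x - w y)\<^sup>2 * (u x)\<^sup>2 \<le> 9 * (s x)\<^sup>2 * (u x)\<^sup>2"
        using s_square_diff[OF True] by (intro mult_right_mono) (auto simp: w_def)
      then show ?thesis using True by (intro mult_left_mono) (auto simp: g_def)
    next
      case False
      then have "c x y = 0" using c_nonneg[of x y] by simp
      then show ?thesis by simp
    qed
  qed
  also have "\<dots> = (\<Sum>x\<in>S. (w x)\<^sup>2 * u x * ((1 + kill_rate x) * cond_tot c x * u x - (\<Sum>y\<in>T. c x y * u y))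
       - 3/2 * (cond_tot c x * (s x)\<^sup>2 * (u x)\<^sup>2))"
  proof (rule sum.cong[OF refl])
    fix x assume x: "x \<in> S"
    have C: "(\<Sum>y\<in>T. c x y) = cond_tot c x"
      using sum_T[OF x, of "\<lambda>_. 1"] by (simp add: cond_tot_def)
    have k: "(w x)\<^sup>2 * kill_rate x = 6 * (s x)\<^sup>2"
      using s_ge_1[of x] by (simp add: w_def kill_rate_def power2_eq_square)
    have "(\<Sum>y\<in>T. c x y * ((w x)\<^sup>2 * (u x)\<^sup>2 - (w x)\<^sup>2 * u x * u y + 9/2 * (s x)\<^sup>2 * (u x)\<^sup>2))
        = (\<Sum>y\<in>T. c x y * ((w x)\<^sup>2 * (u x)\<^sup>2 + 9/2 * (s x)\<^sup>2 * (u x)\<^sup>2) - (w x)\<^sup>2 * u x * (c x y * u y))"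
      by (intro sum.cong) (auto simp: algebra_simps)
    also have "\<dots> = cond_tot c x * ((w x)\<^sup>2 * (u x)\<^sup>2 + 9/2 * (s x)\<^sup>2 * (u x)\<^sup>2) - (w x)\<^sup>2 * u x * (\<Sum>y\<in>T. c x y * u y)"
      by (simp add: sum_subtractf C flip: sum_distrib_left sum_distrib_right)
    also have "\<dots> = (w x)\<^sup>2 * u x * ((1 + kill_rate x) * cond_tot c x * u x - (\<Sum>y\<in>T. c x y * u y))
       - ((w x)\<^sup>2 * kill_rate x - 9/2 * (s x)\<^sup>2) * (cond_tot c x * (u x)\<^sup>2)"
      by (simp add: algebra_simps power2_eq_square)
    finally show "(\<Sum>y\<in>T. c x y * ((w x)\<^sup>2 * (u x)\<^sup>2 - (w x)\<^sup>2 * u x * u y + 9/2 * (s x)\<^sup>2 * (u x)\<^sup>2))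
      = (w x)\<^sup>2 * u x * ((1 + kill_rate x) * cond_tot c x * u x - (\<Sum>y\<in>T. c x y * u y))
       - 3/2 * (cond_tot c x * (s x)\<^sup>2 * (u x)\<^sup>2)"
      unfolding k by simp
  qed
  also have "\<dots> \<le> 7 * cond_tot c root - 3/2 * A"
    using upper by (simp add: sum_subtractf A_def sum_distrib_left)
  \<comment> \<open>14/3 is rounded up to 5.\<close>
  finally have "A \<le> 5 * cond_tot c root"
    using cond_tot_pos[of root] by simp
  moreover have "\<delta> * (s x * u x)\<^sup>2 \<le> A"
  proof (cases "x \<in> S")
    case True
    have "\<delta> * (s x * u x)\<^sup>2 \<le> cond_tot c x * (s x)\<^sup>2 * (u x)\<^sup>2"
      using cond_tot_ge[of x] by (simp add: power_mult_distrib mult.assoc mult_right_mono)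
    also have "\<dots> \<le> A"
      unfolding A_def using True fin cond_tot_pos by (intro member_le_sum) (auto simp: S_def less_imp_le)
    finally show ?thesis .
  next
    case False
    then show ?thesis using cond_tot_pos by (auto simp: S_def A_def less_imp_le intro!: sum_nonneg)
  qed
  ultimately have "\<delta> * (s x * u x)\<^sup>2 \<le> 5 * cond_tot c root" by linarith
  then have "(s x * u x)\<^sup>2 \<le> 5 * cond_tot c root / \<delta>"
    using \<delta>_pos by (simp add: field_simps)
  then have "s x * u x \<le> sqrt (5 * cond_tot c root / \<delta>)"
    by (rule real_le_rsqrt)
  then show ?thesis
    using s_ge_1[of x] by (simp add: field_simps)
qed

text \<open>Probability that the killed walk reaches \<open>root\<close> within \<open>k\<close>
  steps. For fixed \<open>k\<close> the support is finite, as the energy estimate requires.\<close>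

primrec hit_within :: "nat \<Rightarrow> 'v \<Rightarrow> real" where
  "hit_within 0 x = (if x = root then 1 else 0)"
| "hit_within (Suc k) x = (if x = root then 1 else
     (\<Sum>y\<in>nbrs x. trans_prob c x y * hit_within k y) / (1 + kill_rate x))"

lemma hit_within_root: "hit_within k root = 1"
  by (cases k) auto

lemma hit_within_nonneg: "0 \<le> hit_within k x"
proof (induction k arbitrary: x)
  case (Suc k)
  then show ?case
    using kill_rate_pos[of x] by (auto intro!: divide_nonneg_pos sum_nonneg mult_nonneg_nonneg trans_prob_nonneg)
qed auto

lemma hit_within_le_1: "hit_within k x \<le> 1"
proof (induction k arbitrary: x)
  case (Suc k)
  have "(\<Sum>y\<in>nbrs x. trans_prob c x y * hit_within k y) \<le> (\<Sum>y\<in>nbrs x. trans_prob c x y * 1)"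
    by (intro sum_mono mult_left_mono Suc trans_prob_nonneg)
  then show ?case
    using kill_rate_pos[of x] sum_trans_prob[of x] by (simp add: divide_simps)
qed auto

text \<open>Monotonicity in \<open>k\<close> gives convergence to \<open>hit\<close> and turns the
  recursion into the inequality required by \<open>subsolution_decay\<close>.\<close>

lemma hit_within_Suc: "hit_within k x \<le> hit_within (Suc k) x"
proof (induction k arbitrary: x)
  case 0
  then show ?case using hit_within_nonneg[of "Suc 0" x] by auto
next
  case (Suc k)
  then show ?case
    using kill_rate_pos[of x] unfolding hit_within.simps(2)[of "Suc k"] hit_within.simps(2)[of k x]
    by (auto intro!: divide_right_mono sum_mono mult_left_mono trans_prob_nonneg simp del: hit_within.simps)
qed

lemma finite_support_hit_within: "finite {x. hit_within k x \<noteq> 0}"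
proof (induction k)
  case (Suc k)
  have "{x. hit_within (Suc k) x \<noteq> 0} \<subseteq> {root} \<union> (\<Union>y\<in>{x. hit_within k x \<noteq> 0}. nbrs y)"
  proof
    fix x assume "x \<in> {x. hit_within (Suc k) x \<noteq> 0}"
    moreover have "\<exists>y\<in>nbrs x. hit_within k y \<noteq> 0" if "(\<Sum>y\<in>nbrs x. trans_prob c x y * hit_within k y) \<noteq> 0"
      using that by (metis (mono_tags, lifting) mult_zero_right sum.neutral)
    ultimately show "x \<in> {root} \<union> (\<Union>y\<in>{x. hit_within k x \<noteq> 0}. nbrs y)"
      using c_sym by (auto split: if_splits)
  qed
  moreover have "finite ({root} \<union> (\<Union>y\<in>{x. hit_within k x \<noteq> 0}. nbrs y))"
    using Suc finite_nbrs by auto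
  ultimately show ?case by (rule finite_subset)
qed auto

lemma hit_within_pos:
  assumes "(x, root) \<in> adj_rel c ^^ n"
  shows "0 < hit_within n x"
  using assms
proof (induction n arbitrary: x)
  case (Suc n)
  then obtain y where y: "(x, y) \<in> adj_rel c" "(y, root) \<in> adj_rel c ^^ n"
    by (meson relpow_Suc_D2)
  have "0 < trans_prob c x y * hit_within n y"
    using y Suc.IH cond_tot_pos[of x] by (simp add: trans_prob_def adj_rel_def)
  also have "\<dots> \<le> (\<Sum>y\<in>nbrs x. trans_prob c x y * hit_within n y)"
    using y finite_nbrs by (intro member_le_sum)
      (auto simp: adj_rel_def intro!: mult_nonneg_nonneg trans_prob_nonneg hit_within_nonneg)
  finally show ?case using kill_rate_pos[of x] by (simp add: add_pos_pos)
qed auto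

definition hit :: "'v \<Rightarrow> real" where "hit x = (SUP k. hit_within k x)"

lemma bdd_above_hit_within: "bdd_above (range (\<lambda>k. hit_within k x))"
  using hit_within_le_1 by (auto intro!: bdd_aboveI[of _ 1])

lemma hit_within_le_hit: "hit_within k x \<le> hit x"
  unfolding hit_def by (intro cSUP_upper bdd_above_hit_within) auto

lemma hit_within_tendsto: "(\<lambda>k. hit_within k x) \<longlonglongrightarrow> hit x"
  unfolding hit_def by (intro LIMSEQ_incseq_SUP bdd_above_hit_within incseq_SucI hit_within_Suc)

lemma hit_pos: "0 < hit x"
  using hit_within_pos[OF graph_dist_relpow] hit_within_le_hit by (rule order.strict_trans2)

lemma hit_le_1: "hit x \<le> 1"
  unfolding hit_def by (intro cSUP_least hit_within_le_1) auto

text \<open>At \<open>root\<close> the value is 1, the largest possible; elsewhere the recursion for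
  \<open>hit_within\<close> passes to the limit.\<close>

lemma hit_excessive: "(\<Sum>y\<in>nbrs x. trans_prob c x y * hit y) \<le> (1 + kill_rate x) * hit x"
proof (cases "x = root")
  case True
  have "(\<Sum>y\<in>nbrs x. trans_prob c x y * hit y) \<le> (\<Sum>y\<in>nbrs x. trans_prob c x y * 1)"
    by (intro sum_mono mult_left_mono hit_le_1 trans_prob_nonneg)
  moreover have "1 \<le> hit root"
    using hit_within_le_hit[of 0 root] by simp
  moreover have "1 * 1 \<le> (1 + kill_rate root) * hit root"
    using calculation(2) kill_rate_pos[of root] by (intro mult_mono) auto
  ultimately show ?thesis using True by (simp add: sum_trans_prob)
next
  case False
  have "(\<lambda>k. \<Sum>y\<in>nbrs x. trans_prob c x y * hit_within k y) \<longlonglongrightarrow> (\<Sum>y\<in>nbrs x. trans_prob c x y * hit y)"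
    by (intro tendsto_sum tendsto_mult_left hit_within_tendsto)
  moreover have "(\<Sum>y\<in>nbrs x. trans_prob c x y * hit_within k y) \<le> (1 + kill_rate x) * hit x" for k
    using hit_within_le_hit[of "Suc k" x] False kill_rate_pos[of x] by (simp add: divide_simps mult.commute)
  ultimately show ?thesis by (intro LIMSEQ_le_const2) auto
qed

text \<open>The bound of \<open>subsolution_decay\<close> for \<open>hit_within k\<close> does not
  depend on \<open>k\<close>.\<close>

lemma hit_decay: "hit x \<le> sqrt (5 * cond_tot c root / \<delta>) / s x"
  unfolding hit_def
proof (rule cSUP_least)
  fix k
  show "hit_within k x \<le> sqrt (5 * cond_tot c root / \<delta>) / s x"
  proof (rule subsolution_decay)
    fix x assume x: "x \<noteq> root"
    have "(1 + kill_rate x) * cond_tot c x * hit_within k x \<le> (1 + kill_rate x) * cond_tot c x * hit_within (Suc k) x"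
      using kill_rate_pos[of x] cond_tot_pos[of x] by (intro mult_left_mono hit_within_Suc) auto
    also have "\<dots> = cond_tot c x * (\<Sum>y\<in>nbrs x. trans_prob c x y * hit_within k y)"
      using x kill_rate_pos[of x] by simp
    also have "\<dots> = (\<Sum>y\<in>nbrs x. c x y * hit_within k y)"
      using cond_tot_pos[of x] by (simp add: sum_distrib_left trans_prob_def)
    finally show "(1 + kill_rate x) * cond_tot c x * hit_within k x \<le> (\<Sum>y\<in>nbrs x. c x y * hit_within k y)" .
  qed (auto simp: finite_support_hit_within hit_within_nonneg hit_within_root)
qed auto

end

sublocale conductance_network \<subseteq> killed_chain nbrs "trans_prob c" kill_rate hit
  by unfold_locales
    (auto simp: trans_prob_nonneg sum_trans_prob hit_pos hit_le_1 hit_excessive less_imp_le[OF kill_rate_pos])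

section \<open>Laws of finite paths and the Markov property\<close>

locale network_walk = conductance_network c root \<delta>
  for c :: "'v \<Rightarrow> 'v \<Rightarrow> real" and root \<delta> +
  fixes M :: "'a measure" and X :: "nat \<Rightarrow> 'a \<Rightarrow> 'v"
  assumes random_walk: "random_walk M c X"
begin

sublocale prob_space M
  using random_walk by (simp add: random_walk_def)

lemma measurable_X [measurable]: "X n \<in> measurable M (count_space UNIV)"
  using random_walk by (simp add: random_walk_def)

definition walk_path :: "nat \<Rightarrow> 'a \<Rightarrow> 'v list" where
  "walk_path n \<omega> = map (\<lambda>i. X i \<omega>) [0..<Suc n]"

lemma walk_path_eq_iff: "walk_path n \<omega> = xs \<longleftrightarrow> length xs = Suc n \<and> (\<forall>i\<le>n. X i \<omega> = xs ! i)"
  by (auto simp: walk_path_def list_eq_iff_nth_eq less_Suc_eq_le simp del: upt_Suc)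

lemma last_walk_path: "last (walk_path n \<omega>) = X n \<omega>"
  by (simp add: walk_path_def)

lemma length_walk_path: "length (walk_path n \<omega>) = Suc n"
  by (simp add: walk_path_def)

lemma nth_walk_path: "i \<le> n \<Longrightarrow> walk_path n \<omega> ! i = X i \<omega>"
  by (simp add: walk_path_def del: upt_Suc)

lemma countable_paths: "countable (UNIV :: 'v list set)"
  using countable_vertices countable_lists[of "UNIV :: 'v set"] by (simp add: lists_UNIV)

lemma measurable_walk_path [measurable]: "walk_path n \<in> measurable M (count_space UNIV)"
  unfolding measurable_count_space_eq_countable[OF countable_paths]
proof (intro conjI ballI)
  fix xs :: "'v list"
  have "walk_path n -` {xs} \<inter> space M = {\<omega> \<in> space M. length xs = Suc n \<and> (\<forall>i\<le>n. X i \<omega> = xs ! i)}"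
    using walk_path_eq_iff[of n _ xs] by blast
  also have "\<dots> \<in> sets M" by measurable
  finally show "walk_path n -` {xs} \<inter> space M \<in> sets M" .
qed auto

text \<open>Such an event is the preimage under \<open>walk_path n\<close> of a set of lists, and
  every set of lists is measurable in the counting space.\<close>

lemma sets_walk_path:
  assumes "\<And>\<omega> \<omega>'. (\<And>i. i \<le> n \<Longrightarrow> X i \<omega> = X i \<omega>') \<Longrightarrow> P \<omega> = P \<omega>'"
  shows "{\<omega> \<in> space M. P \<omega>} \<in> sets M"
proof -
  have "P \<omega> = P \<omega>'" if "walk_path n \<omega> = walk_path n \<omega>'" for \<omega> \<omega>'
  proof (rule assms)
    fix i assume "i \<le> n"
    then show "X i \<omega> = X i \<omega>'"
      using nth_walk_path[of i n] that by metis
  qed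
  then have "{\<omega> \<in> space M. P \<omega>} = walk_path n -` (walk_path n ` {\<omega> \<in> space M. P \<omega>}) \<inter> space M"
    by blast
  also have "\<dots> \<in> sets M"
    by (rule measurable_sets[OF measurable_walk_path]) simp
  finally show ?thesis .
qed

text \<open>A \<open>pmf\<close>, so that the Markov property can be checked on point
  masses.\<close>

definition path_law :: "nat \<Rightarrow> 'v list pmf" where
  "path_law n = Abs_pmf (distr M (count_space UNIV) (walk_path n))"

lemma measure_path_law: "measure_pmf (path_law n) = distr M (count_space UNIV) (walk_path n)"
  unfolding path_law_def
proof (rule Abs_pmf_inverse, safe)
  interpret D: prob_space "distr M (count_space UNIV) (walk_path n)"
    by (rule prob_space_distr) measurable
  show "prob_space (distr M (count_space UNIV) (walk_path n))" by unfold_locales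
  show "AE x in distr M (count_space UNIV) (walk_path n). measure (distr M (count_space UNIV) (walk_path n)) {x} \<noteq> 0"
    using D.AE_support_countable countable_paths by auto
qed auto

lemma expectation_walk_path:
  fixes G :: "'v list \<Rightarrow> real"
  shows "expectation (\<lambda>\<omega>. G (walk_path n \<omega>)) = measure_pmf.expectation (path_law n) G"
  by (simp add: measure_path_law integral_distr)

lemma integrable_walk_path:
  fixes G :: "'v list \<Rightarrow> real"
  assumes "\<And>zs. \<bar>G zs\<bar> \<le> B"
  shows "integrable M (\<lambda>\<omega>. G (walk_path n \<omega>))"
  using assms by (intro integrable_const_bound[of _ B] measurable_compose[OF measurable_walk_path]) auto

lemma pmf_path_law: "pmf (path_law n) xs = prob {\<omega> \<in> space M. walk_path n \<omega> = xs}"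
  by (simp add: pmf.rep_eq measure_path_law measure_distr vimage_def Int_def conj_commute)

definition step :: "'v \<Rightarrow> 'v pmf" where "step x = embed_pmf (trans_prob c x)"

lemma trans_prob_eq_0: "y \<notin> nbrs x \<Longrightarrow> trans_prob c x y = 0"
  using c_nonneg[of x y] by (simp add: trans_prob_def)

lemma pmf_step: "pmf (step x) y = trans_prob c x y"
  unfolding step_def
proof (rule pmf_embed_pmf)
  have "(\<integral>\<^sup>+ y. ennreal (trans_prob c x y) \<partial>count_space UNIV) = (\<Sum>y\<in>nbrs x. ennreal (trans_prob c x y))"
    using trans_prob_eq_0 by (intro nn_integral_count_space' finite_nbrs) auto
  also have "\<dots> = 1"
    by (simp add: sum_ennreal trans_prob_nonneg sum_trans_prob)
  finally show "(\<integral>\<^sup>+ y. ennreal (trans_prob c x y) \<partial>count_space UNIV) = 1" .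
qed (rule trans_prob_nonneg)

lemma path_law_Suc:
  "path_law (Suc n) = bind_pmf (path_law n) (\<lambda>xs. map_pmf (\<lambda>y. xs @ [y]) (step (last xs)))"
proof (rule pmf_eqI)
  fix zs :: "'v list"
  show "pmf (path_law (Suc n)) zs = pmf (bind_pmf (path_law n) (\<lambda>xs. map_pmf (\<lambda>y. xs @ [y]) (step (last xs)))) zs"
  proof (cases zs rule: rev_cases)
    case Nil
    then show ?thesis
      by (auto simp: pmf_path_law walk_path_eq_iff pmf_bind pmf_map vimage_def)
  next
    case (snoc xs y)
    have "pmf (map_pmf (\<lambda>y. ws @ [y]) (step (last ws))) (xs @ [y]) = indicator {xs} ws * trans_prob c (last xs) y" for ws
    proof (cases "ws = xs")
      case True
      have "pmf (map_pmf (\<lambda>y. xs @ [y]) (step (last xs))) ((\<lambda>y. xs @ [y]) y) = pmf (step (last xs)) y"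
        by (rule pmf_map_inj') (auto simp: inj_def)
      then show ?thesis using True by (simp add: pmf_step)
    next
      case False
      then show ?thesis by (auto simp: pmf_map vimage_def)
    qed
    then have "pmf (bind_pmf (path_law n) (\<lambda>xs. map_pmf (\<lambda>y. xs @ [y]) (step (last xs)))) zs
        = pmf (path_law n) xs * trans_prob c (last xs) y"
      by (simp add: snoc pmf_bind measure_pmf_single)
    also have "\<dots> = pmf (path_law (Suc n)) zs"
    proof (cases "length xs = Suc n")
      case True
      define f where "f = (\<lambda>i. zs ! i)"
      have f: "f n = last xs" "f (Suc n) = y" "\<And>i. i \<le> n \<Longrightarrow> f i = xs ! i"
        using True last_conv_nth[of xs] by (auto simp: f_def snoc nth_append simp flip: length_0_conv)
      have "prob {\<omega> \<in> space M. \<forall>i\<le>Suc n. X i \<omega> = f i}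
         = prob {\<omega> \<in> space M. \<forall>i\<le>n. X i \<omega> = f i} * trans_prob c (f n) (f (Suc n))"
        using random_walk by (simp add: random_walk_def)
      moreover have "{\<omega> \<in> space M. walk_path (Suc n) \<omega> = zs} = {\<omega> \<in> space M. \<forall>i\<le>Suc n. X i \<omega> = f i}"
        using True by (auto simp: walk_path_eq_iff f_def snoc)
      moreover have "{\<omega> \<in> space M. walk_path n \<omega> = xs} = {\<omega> \<in> space M. \<forall>i\<le>n. X i \<omega> = f i}"
        using True f(3) by (auto simp: walk_path_eq_iff)
      ultimately show ?thesis
        using f by (simp add: pmf_path_law)
    next
      case False
      then show ?thesis by (simp add: pmf_path_law walk_path_eq_iff snoc)
    qed
    finally show ?thesis by simp
  qed
qed

lemma expectation_walk_path_Suc: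
  fixes G :: "'v list \<Rightarrow> real"
  assumes "\<And>zs. \<bar>G zs\<bar> \<le> B"
  shows "expectation (\<lambda>\<omega>. G (walk_path (Suc n) \<omega>))
    = expectation (\<lambda>\<omega>. \<Sum>y\<in>nbrs (X n \<omega>). trans_prob c (X n \<omega>) y * G (walk_path n \<omega> @ [y]))"
proof -
  have "measure_pmf.expectation (map_pmf (\<lambda>y. xs @ [y]) (step (last xs))) G
      = (\<Sum>y\<in>nbrs (last xs). trans_prob c (last xs) y * G (xs @ [y]))" for xs
    unfolding integral_map_pmf
    by (subst integral_measure_pmf[OF finite_nbrs[of "last xs"]])
       (use trans_prob_eq_0[of _ "last xs"] in \<open>auto simp: set_pmf_eq pmf_step\<close>)
  moreover have "measure_pmf.expectation (path_law (Suc n)) G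
      = measure_pmf.expectation (path_law n) (\<lambda>xs. measure_pmf.expectation (map_pmf (\<lambda>y. xs @ [y]) (step (last xs))) G)"
    unfolding path_law_Suc measure_pmf_bind using assms
    by (intro integral_bind[where K = "count_space UNIV" and B = B and B' = 1])
       (auto simp: measure_pmf.emeasure_space_1 measure_pmf_in_subprob_space)
  ultimately show ?thesis
    by (simp add: expectation_walk_path[symmetric] last_walk_path)
qed

text \<open>Markov property over \<open>n\<close> steps: the later steps are integrated into a
  bounded function \<open>H\<close> of the path up to time m + 1, to which the one-step identity
  applies.\<close>

lemma expectation_walk_path_add:
  fixes G :: "'v list \<Rightarrow> real"
  assumes "\<And>zs. \<bar>G zs\<bar> \<le> B"
  shows "expectation (\<lambda>\<omega>. G (walk_path (m + n) \<omega>))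
    = expectation (\<lambda>\<omega>. expect n (X m \<omega>) (\<lambda>ys. G (walk_path m \<omega> @ ys)))"
proof (induction n arbitrary: m)
  case (Suc n)
  define H where "H zs = expect n (last zs) (\<lambda>ys. G (zs @ ys))" for zs
  have "\<bar>H zs\<bar> \<le> B" for zs
    unfolding H_def using assms by (rule abs_expect_le)
  have "expectation (\<lambda>\<omega>. G (walk_path (m + Suc n) \<omega>)) = expectation (\<lambda>\<omega>. H (walk_path (Suc m) \<omega>))"
    using Suc[of "Suc m"] by (simp add: H_def last_walk_path)
  also have "\<dots> = expectation (\<lambda>\<omega>. \<Sum>y\<in>nbrs (X m \<omega>). trans_prob c (X m \<omega>) y * H (walk_path m \<omega> @ [y]))"
    by (rule expectation_walk_path_Suc) fact
  finally show ?case by (simp add: H_def)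
qed simp

section \<open>From rewards to separating levels\<close>

text \<open>A cut time within a finite window, witnessed by a level \<open>a\<close> of
  \<open>hit\<close>. As a > b, it is a cut time of the whole walk if the walk stays at or below
  \<open>b\<close> after the window.\<close>

definition separated :: "real \<Rightarrow> nat \<Rightarrow> nat \<Rightarrow> 'a \<Rightarrow> bool" where
  "separated b m N \<omega> \<longleftrightarrow> (\<exists>n a. m \<le> n \<and> n < m + N \<and> b < a \<and> (\<forall>i\<le>n. a \<le> hit (X i \<omega>)) \<and>
     (\<forall>i. n < i \<longrightarrow> i \<le> m + N \<longrightarrow> hit (X i \<omega>) < a))"

text \<open>Optional stopping over \<open>N\<close> steps from time \<open>m\<close> on the event
  \<open>F\<close>, with s0 = 1/N and the minimum of the past as initial level. The term with
  \<theta> bounds the initial depth, the final 2 the loss by small drops, and \<gamma> the chance of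
  being killed when the total rate is at most \<gamma>.\<close>

lemma separation_bound:
  assumes "2 \<le> N" "0 < \<theta>" and K: "K = ln (real N) / 4" and "0 \<le> \<gamma>"
    and F: "\<And>zs. F zs \<Longrightarrow> zs \<noteq> [] \<and> (\<forall>z\<in>set zs. \<theta> \<le> hit z)"
  shows "K * prob {\<omega> \<in> space M. F (walk_path m \<omega>) \<and> hit (X (m + N) \<omega>) \<le> exp (- K)}
    \<le> (2 + 7 * K) * (prob {\<omega> \<in> space M. F (walk_path m \<omega>) \<and> separated (exp (- K)) m N \<omega>}
         + \<gamma> + prob {\<omega> \<in> space M. \<gamma> < (\<Sum>i=m..<m + N. kill_rate (X i \<omega>))})
       + \<bar>ln \<theta>\<bar> + 2"
proof -
  interpret level_search nbrs "trans_prob c" kill_rate hit K "1 / real N"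
    using assms(1) by unfold_locales (auto simp: K)
  define low where "low zs = Min (hit ` set zs)" for zs
  define G where "G zs = (let us = take (Suc m) zs in
      if F us then reward None (low us) (last us) (drop (Suc m) zs) else 0)" for zs
  define Sep where "Sep \<omega> \<longleftrightarrow> F (walk_path m \<omega>) \<and> separated (exp (- K)) m N \<omega>" for \<omega>
  define Small where "Small \<omega> \<longleftrightarrow> F (walk_path m \<omega>) \<and> hit (X (m + N) \<omega>) \<le> exp (- K)" for \<omega>
  define Big where "Big \<omega> \<longleftrightarrow> \<gamma> < (\<Sum>i=m..<m + N. kill_rate (X i \<omega>))" for \<omega>
  have path_cong: "walk_path m \<omega> = walk_path m \<omega>'" if "\<And>i. i \<le> m + N \<Longrightarrow> X i \<omega> = X i \<omega>'" for \<omega> \<omega>'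
    using that unfolding walk_path_def by (intro map_cong) auto
  have [measurable]: "{\<omega> \<in> space M. Sep \<omega>} \<in> sets M"
  proof (rule sets_walk_path[of "m + N"])
    fix \<omega> \<omega>' assume eq: "\<And>i. i \<le> m + N \<Longrightarrow> X i \<omega> = X i \<omega>'"
    then have "separated (exp (- K)) m N \<omega> = separated (exp (- K)) m N \<omega>'"
      unfolding separated_def by (intro ex_cong1 conj_cong refl) auto
    then show "Sep \<omega> = Sep \<omega>'"
      using path_cong[OF eq] by (simp add: Sep_def)
  qed
  have [measurable]: "{\<omega> \<in> space M. Small \<omega>} \<in> sets M"
  proof (rule sets_walk_path[of "m + N"])
    fix \<omega> \<omega>' assume eq: "\<And>i. i \<le> m + N \<Longrightarrow> X i \<omega> = X i \<omega>'"
    then show "Small \<omega> = Small \<omega>'"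
      using path_cong[OF eq] by (simp add: Small_def)
  qed
  have [measurable]: "{\<omega> \<in> space M. Big \<omega>} \<in> sets M"
    by (rule sets_walk_path[of "m + N"]) (simp add: Big_def)
  have int: "integrable M (indicat_real {\<omega> \<in> space M. Sep \<omega>})"
    "integrable M (indicat_real {\<omega> \<in> space M. Small \<omega>})"
    "integrable M (indicat_real {\<omega> \<in> space M. Big \<omega>})"
    by (auto simp: emeasure_eq_measure)
  \<comment> \<open>Here - ln s0 = ln N = 4 K.\<close>
  have L_eq: "L = 2 + 7 * K" using assms(1) unfolding L_def by (simp add: ln_div K)
  have low: "0 < low zs" "low zs \<le> 1" "low zs \<le> hit (last zs)" "\<And>z. z \<in> set zs \<Longrightarrow> low zs \<le> hit z" if "zs \<noteq> []" for zs
  proof -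
    show "0 < low zs" using that hit_pos by (simp add: low_def)
    show *: "low zs \<le> hit z" if "z \<in> set zs" for z using that by (simp add: low_def)
    show "low zs \<le> hit (last zs)" using that by (intro *) auto
    then show "low zs \<le> 1" using hit_le_1[of "last zs"] by linarith
  qed
  have L0: "0 \<le> L" using L_ge K_nonneg by linarith
  have G_bound: "\<bar>G zs\<bar> \<le> L" for zs
  proof (cases "F (take (Suc m) zs)")
    case True
    then have "take (Suc m) zs \<noteq> []" using F by blast
    then show ?thesis
      unfolding G_def Let_def if_P[OF True] by (intro abs_reward_le low)
  qed (simp add: G_def L0)
  have m: "take (Suc m) (walk_path m \<omega> @ ys) = walk_path m \<omega>" "drop (Suc m) (walk_path m \<omega> @ ys) = ys" for \<omega> ys
    by (auto simp: length_walk_path)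
  have Nlog: "- 2 \<le> real N * ln (1 - 1 / real N)"
  proof -
    have N: "2 \<le> real N" using assms(1) by simp
    have "1 - 1 / real N = (real N - 1) / real N"
      using N by (simp add: field_simps)
    then have "- ln (1 - 1 / real N) = ln (real N / (real N - 1))"
      using N by (simp add: ln_div)
    also have "\<dots> \<le> real N / (real N - 1) - 1"
      using N by (intro ln_le_minus_one) auto
    also have "\<dots> = 1 / (real N - 1)" using N by (simp add: field_simps)
    also have "\<dots> \<le> 2 / real N" using N by (simp add: field_simps)
    finally have "real N * (- ln (1 - 1 / real N)) \<le> real N * (2 / real N)"
      using N by (intro mult_left_mono) auto
    then show ?thesis using N by simp
  qed
  have "- \<bar>ln \<theta>\<bar> - 2 = expectation (\<lambda>_. - \<bar>ln \<theta>\<bar> - 2)" by (simp add: prob_space)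
  \<comment> \<open>Pathwise at time \<open>m\<close>: off \<open>F\<close> the functional is 0, on
    \<open>F\<close> \<open>expect_reward_ge\<close> applies.\<close>
  also have "\<dots> \<le> expectation (\<lambda>\<omega>. expect N (X m \<omega>) (\<lambda>ys. G (walk_path m \<omega> @ ys)))"
  proof (rule integral_mono)
    have "integrable M (\<lambda>\<omega>. (\<lambda>zs. expect N (last zs) (\<lambda>ys. G (zs @ ys))) (walk_path m \<omega>))"
      by (intro integrable_walk_path[of _ L] abs_expect_le G_bound)
    then show "integrable M (\<lambda>\<omega>. expect N (X m \<omega>) (\<lambda>ys. G (walk_path m \<omega> @ ys)))"
      by (simp add: last_walk_path)
    fix \<omega>
    show "- \<bar>ln \<theta>\<bar> - 2 \<le> expect N (X m \<omega>) (\<lambda>ys. G (walk_path m \<omega> @ ys))"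
    proof (cases "F (walk_path m \<omega>)")
      case False
      then have "expect N (X m \<omega>) (\<lambda>ys. G (walk_path m \<omega> @ ys)) = expect N (X m \<omega>) (\<lambda>ys. 0)"
        by (simp only: G_def m Let_def if_False)
      also have "\<dots> = 0"
        using abs_expect_le[of "\<lambda>_. 0" 0 N "X m \<omega>"] by simp
      finally show ?thesis by simp
    next
      case True
      define z where "z = low (walk_path m \<omega>)"
      have ne: "walk_path m \<omega> \<noteq> []" and "\<theta> \<le> z"
        using F[OF True] by (auto simp: z_def low_def)
      then have "ln \<theta> \<le> ln z" using assms(2) by simp
      then have "- \<bar>ln \<theta>\<bar> \<le> - capped_log K z"
        using capped_log_bounds(3)[of z K] low[OF ne] K_nonneg by (simp add: z_def)
      moreover have "- capped_log K z + real N * ln (1 - 1 / real N) \<le> expect N (X m \<omega>) (reward None z (X m \<omega>))"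
        using low[OF ne] by (intro expect_reward_ge) (auto simp: z_def last_walk_path)
      moreover have "expect N (X m \<omega>) (\<lambda>ys. G (walk_path m \<omega> @ ys)) = expect N (X m \<omega>) (reward None z (X m \<omega>))"
        using True by (simp only: G_def m Let_def if_True z_def last_walk_path)
      ultimately show ?thesis using Nlog by linarith
    qed
  qed auto
  also have "\<dots> = expectation (\<lambda>\<omega>. G (walk_path (m + N) \<omega>))"
    by (rule expectation_walk_path_add[of G L m N, OF G_bound, symmetric])
  \<comment> \<open>Pathwise again: success gives \<open>Sep\<close>, and outside \<open>Big\<close>
    the probability of having been killed is at most \<gamma>.\<close>
  also have "\<dots> \<le> expectation (\<lambda>\<omega>. L * (indicator {\<omega>\<in>space M. Sep \<omega>} \<omega> + \<gamma> + indicator {\<omega>\<in>space M. Big \<omega>} \<omega>)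
       - K * indicator {\<omega>\<in>space M. Small \<omega>} \<omega>)"
  proof (rule integral_mono)
    show "integrable M (\<lambda>\<omega>. G (walk_path (m + N) \<omega>))"
      using G_bound by (rule integrable_walk_path)
    show "integrable M (\<lambda>\<omega>. L * (indicator {\<omega>\<in>space M. Sep \<omega>} \<omega> + \<gamma> + indicator {\<omega>\<in>space M. Big \<omega>} \<omega>)
       - K * indicator {\<omega>\<in>space M. Small \<omega>} \<omega>)"
      by (simp add: int)
    fix \<omega> assume \<omega>: "\<omega> \<in> space M"
    define us where "us = walk_path m \<omega>"
    define ys where "ys = map (\<lambda>i. X i \<omega>) [Suc m..<Suc (m + N)]"
    have path: "walk_path (m + N) \<omega> = us @ ys"
      using upt_add_eq_append[of 0 "Suc m" N]
      by (simp add: walk_path_def us_def ys_def del: upt_Suc flip: map_append)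
    have last: "last (X m \<omega> # ys) = X (m + N) \<omega>"
      by (cases "N = 0") (simp_all add: ys_def)
    have G: "G (walk_path (m + N) \<omega>) = (if F us then reward None (low us) (X m \<omega>) ys else 0)"
      unfolding path G_def Let_def us_def m last_walk_path ..
    show "G (walk_path (m + N) \<omega>) \<le> L * (indicator {\<omega>\<in>space M. Sep \<omega>} \<omega> + \<gamma> + indicator {\<omega>\<in>space M. Big \<omega>} \<omega>)
       - K * indicator {\<omega>\<in>space M. Small \<omega>} \<omega>"
    proof (cases "F us")
      case False
      then show ?thesis
        unfolding G using L0 assms(4) by (simp add: Small_def us_def)
    next
      case True
      have us: "us \<noteq> []" using F[OF True] by simp
      have "success None (low us) ys \<Longrightarrow> Sep \<omega>"
      proof -
        assume "success None (low us) ys"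
        from success_imp_separated[OF this] obtain vs ws a where sep:
          "ys = vs @ ws" "ws \<noteq> []" "exp (- K) < a" "a \<le> low us" "\<forall>y\<in>set vs. a \<le> hit y" "\<forall>y\<in>set ws. hit y < a"
          by auto
        \<comment> \<open>\<open>us @ vs\<close> has n + 1 entries, the last being X n; n < m + N
          because \<open>ws\<close> is nonempty.\<close>
        define n where "n = m + length vs"
        have len: "length vs + length ws = N"
          using arg_cong[OF sep(1), of length] by (simp add: ys_def del: upt_Suc)
        have all: "map (\<lambda>i. X i \<omega>) [0..<Suc (m + N)] = (us @ vs) @ ws"
          using path sep(1) by (simp add: walk_path_def)
        have nth: "X i \<omega> = ((us @ vs) @ ws) ! i" if "i \<le> m + N" for i
          unfolding all[symmetric] using that by (simp del: upt_Suc)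
        have lus: "length (us @ vs) = Suc n"
          by (simp add: us_def n_def length_walk_path)
        have "a \<le> hit (X i \<omega>)" if "i \<le> n" for i
        proof -
          have "X i \<omega> = (us @ vs) ! i"
            using nth[of i] that len lus by (simp add: n_def nth_append del: append_assoc)
          then have "X i \<omega> \<in> set (us @ vs)"
            using that lus by (metis less_Suc_eq_le nth_mem)
          then show ?thesis using sep(4,5) low(4)[OF us] by force
        qed
        moreover have "hit (X i \<omega>) < a" if "n < i" "i \<le> m + N" for i
        proof -
          have "X i \<omega> = ws ! (i - Suc n)"
            using nth[of i] that lus by (simp add: nth_append[of "us @ vs" ws] del: append_assoc length_append)
          moreover have "i - Suc n < length ws"
            using that len by (simp add: n_def)
          ultimately show ?thesis using sep(6) by simp
        qed
        moreover have "m \<le> n" "n < m + N"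
          using len sep(2) by (auto simp: n_def)
        ultimately show "Sep \<omega>"
          using sep(3) True unfolding Sep_def separated_def us_def by blast
      qed
      moreover have "1 - survival (X m \<omega>) ys \<le> (\<Sum>i=m..<m + N. kill_rate (X i \<omega>))"
      proof -
        have "X m \<omega> # ys = map (\<lambda>i. X i \<omega>) [m..<Suc (m + N)]"
          by (subst upt_conv_Cons) (auto simp: ys_def)
        then have "butlast (X m \<omega> # ys) = map (\<lambda>i. X i \<omega>) [m..<m + N]"
          by (simp add: map_butlast[symmetric])
        then show ?thesis
          using survival_ge[of "X m \<omega>" ys] by (simp add: comp_def interv_sum_list_conv_sum_set_nat)
      qed
      moreover have "0 < survival (X m \<omega>) ys" "survival (X m \<omega>) ys \<le> 1"
        using survival_bounds by auto
      ultimately have "(if success None (low us) ys then 1 else 1 - survival (X m \<omega>) ys)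
         \<le> indicator {\<omega>\<in>space M. Sep \<omega>} \<omega> + \<gamma> + indicator {\<omega>\<in>space M. Big \<omega>} \<omega>"
        using \<omega> assms(4) by (auto simp: Big_def indicator_def)
      then have "L * (if success None (low us) ys then 1 else 1 - survival (X m \<omega>) ys)
         \<le> L * (indicator {\<omega>\<in>space M. Sep \<omega>} \<omega> + \<gamma> + indicator {\<omega>\<in>space M. Big \<omega>} \<omega>)"
        using L0 by (rule mult_left_mono)
      moreover have "reward None (low us) (X m \<omega>) ys \<le> L * (if success None (low us) ys then 1 else 1 - survival (X m \<omega>) ys)
         - (if hit (last (X m \<omega> # ys)) \<le> exp (- K) then K else 0)"
        using low[OF us] by (intro reward_le) (auto simp: us_def last_walk_path)
      moreover have "K * indicator {\<omega>\<in>space M. Small \<omega>} \<omega> = (if hit (X (m + N) \<omega>) \<le> exp (- K) then K else 0)"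
        using True \<omega> by (simp add: Small_def us_def)
      ultimately show ?thesis
        using True unfolding G last if_P[OF True] by linarith
    qed
  qed
  also have "\<dots> = L * (prob {\<omega>\<in>space M. Sep \<omega>} + \<gamma> + prob {\<omega>\<in>space M. Big \<omega>}) - K * prob {\<omega>\<in>space M. Small \<omega>}"
    by (simp add: int prob_space)
  finally show ?thesis
    unfolding L_eq Sep_def Small_def Big_def by linarith
qed

section \<open>Almost sure existence of late cut times\<close>

lemma measurable_comp_X [measurable]: "(\<lambda>\<omega>. f (X n \<omega>) :: real) \<in> borel_measurable M"
  by (rule measurable_compose[OF measurable_X]) simp

lemma measurable_X_eq [measurable]: "Measurable.pred M (\<lambda>\<omega>. X i \<omega> = X j \<omega>)"
  unfolding pred_def by (rule sets_walk_path[of "max i j"]) simp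

lemma not_cut_time_iff: "\<not> cut_time x n \<longleftrightarrow> (\<exists>j. n < j \<and> (\<exists>i\<le>n. x i = x j))"
  by (auto simp: cut_time_def disjoint_iff)

lemma measurable_cut_time [measurable]: "Measurable.pred M (\<lambda>\<omega>. cut_time (\<lambda>i. X i \<omega>) n)"
proof -
  have "Measurable.pred M (\<lambda>\<omega>. \<not> (\<exists>j. n < j \<and> (\<exists>i\<le>n. X i \<omega> = X j \<omega>)))" by measurable
  then show ?thesis by (simp flip: not_cut_time_iff)
qed

text \<open>Continuity from above along decreasing events with null intersection.\<close>

lemma prob_le_eventually:
  assumes meas [measurable]: "\<And>n. Measurable.pred M (P n)" and dec: "\<And>n \<omega>. P (Suc n) \<omega> \<Longrightarrow> P n \<omega>"
    and ae: "AE \<omega> in M. \<exists>n. \<not> P n \<omega>" and "0 < \<gamma>"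
  shows "\<forall>\<^sub>F n in sequentially. prob {\<omega> \<in> space M. P n \<omega>} \<le> \<gamma>"
proof -
  have "(\<lambda>n. prob {\<omega> \<in> space M. P n \<omega>}) \<longlonglongrightarrow> prob (\<Inter>n. {\<omega> \<in> space M. P n \<omega>})"
    using dec by (intro finite_Lim_measure_decseq decseq_SucI) auto
  moreover have "prob (\<Inter>n. {\<omega> \<in> space M. P n \<omega>}) = prob {}"
    using ae by (intro measure_eq_AE) auto
  ultimately have "(\<lambda>n. prob {\<omega> \<in> space M. P n \<omega>}) \<longlonglongrightarrow> 0" by simp
  from order_tendstoD(2)[OF this \<open>0 < \<gamma>\<close>] show ?thesis
    by eventually_elim simp
qed

text \<open>The event \<open>none\<close> of no cut time after \<open>k\<close> agrees up to a small error with an event \<open>F\<close> of the path up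
  to time \<open>m\<close>. By \<open>separation_bound\<close> from time \<open>m\<close> on, a fixed fraction of \<open>F\<close> would have a cut time after
  \<open>m\<close>, that is, lie outside \<open>none\<close>; so \<open>F\<close> is small.\<close>

lemma prob_no_cut_time_after:
  assumes summ: "AE \<omega> in M. summable (\<lambda>n. kill_rate (X n \<omega>))"
    and decay: "AE \<omega> in M. \<forall>\<^sub>F n in sequentially. hit (X n \<omega>) \<le> real n powr (- 1/4)"
  shows "prob {\<omega> \<in> space M. \<forall>n\<ge>k. \<not> cut_time (\<lambda>i. X i \<omega>) n} = 0"
proof -
  let ?cut = "\<lambda>\<omega> n. cut_time (\<lambda>i. X i \<omega>) n"
  \<comment> \<open>A return seen by time \<open>J\<close> that keeps \<open>n\<close> from being a
    cut time.\<close>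
  define rep where "rep J n \<omega> \<longleftrightarrow> (\<exists>i\<le>n. \<exists>j\<le>J. n < j \<and> X i \<omega> = X j \<omega>)" for J n \<omega>
  have [measurable]: "Measurable.pred M (rep J n)" for J n
    unfolding pred_def
    by (rule sets_walk_path[of "max n J"]) (unfold rep_def, intro ex_cong1 conj_cong refl, simp)
  define none where "none \<omega> \<longleftrightarrow> (\<forall>n\<ge>k. \<not> ?cut \<omega> n)" for \<omega>
  have [measurable]: "Measurable.pred M none" unfolding none_def by measurable
  have rep_imp: "\<not> ?cut \<omega> n" if "rep J n \<omega>" for \<omega> J n
    using that unfolding rep_def not_cut_time_iff by blast
  \<comment> \<open>33 comes from the reward estimate; \<open>P2\<close>, \<open>P4\<close> and
    \<open>P5\<close> add one \<gamma> each.\<close>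
  have bound: "prob {\<omega> \<in> space M. none \<omega>} \<le> 36 * \<gamma>" if \<gamma>: "0 < \<gamma>" for \<gamma>
  proof -
    \<comment> \<open>Error event: the first cut time from \<open>k\<close> on comes after
      \<open>n\<close>.\<close>
    define P1 where "P1 n \<omega> \<longleftrightarrow> (\<forall>i\<in>{k..n}. \<not> ?cut \<omega> i) \<and> \<not> none \<omega>" for n \<omega>
    have [measurable]: "Measurable.pred M (P1 n)" for n unfolding P1_def by measurable
    have "\<forall>\<^sub>F n in sequentially. prob {\<omega> \<in> space M. P1 n \<omega>} \<le> \<gamma>"
    proof (rule prob_le_eventually)
      show "AE \<omega> in M. \<exists>n. \<not> P1 n \<omega>"
        by (rule AE_I2) (unfold P1_def none_def, meson atLeastAtMost_iff order_refl)
      show "P1 n \<omega>" if "P1 (Suc n) \<omega>" for n \<omega>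
        using that by (simp add: P1_def)
    qed (measurable, rule \<gamma>)
    then obtain R where R: "prob {\<omega> \<in> space M. P1 R \<omega>} \<le> \<gamma>"
      by (auto simp: eventually_sequentially)
    \<comment> \<open>Error event: no time in \<open>{k..R}\<close> is a cut time, but for one of
      them no return is seen by time \<open>J\<close>.\<close>
    define P2 where "P2 J \<omega> \<longleftrightarrow> (\<forall>n\<in>{k..R}. \<not> ?cut \<omega> n) \<and> \<not> (\<forall>n\<in>{k..R}. rep J n \<omega>)" for J \<omega>
    have [measurable]: "Measurable.pred M (P2 J)" for J unfolding P2_def by measurable
    have "\<forall>\<^sub>F J in sequentially. prob {\<omega> \<in> space M. P2 J \<omega>} \<le> \<gamma>"
    proof (rule prob_le_eventually)
      have "\<exists>J. \<not> P2 J \<omega>" for \<omega>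
      proof (cases "\<forall>n\<in>{k..R}. \<not> ?cut \<omega> n")
        case True
        have "\<forall>\<^sub>F J in sequentially. rep J n \<omega>" if "n \<in> {k..R}" for n
        proof -
          have "\<not> ?cut \<omega> n" using True that by blast
          then obtain i j where "n < j" "i \<le> n" "X i \<omega> = X j \<omega>"
            unfolding not_cut_time_iff by blast
          then show ?thesis unfolding rep_def by (intro eventually_sequentiallyI[of j]) blast
        qed
        then have "\<forall>\<^sub>F J in sequentially. \<forall>n\<in>{k..R}. rep J n \<omega>"
          by (simp add: eventually_ball_finite_distrib)
        then obtain J where "\<forall>n\<in>{k..R}. rep J n \<omega>"
          unfolding eventually_sequentially by blast
        then have "\<not> P2 J \<omega>" unfolding P2_def by blast
        then show ?thesis ..
      next
        case False
        then have "\<not> P2 0 \<omega>" unfolding P2_def by blast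
        then show ?thesis ..
      qed
      then show "AE \<omega> in M. \<exists>J. \<not> P2 J \<omega>" by simp
      show "P2 J \<omega>" if "P2 (Suc J) \<omega>" for J \<omega>
      proof -
        have "rep (Suc J) n \<omega>" if "rep J n \<omega>" for n
          using that le_SucI unfolding rep_def by blast
        with that show ?thesis unfolding P2_def by blast
      qed
    qed (measurable, rule \<gamma>)
    then obtain J where J: "prob {\<omega> \<in> space M. P2 J \<omega>} \<le> \<gamma>"
      by (auto simp: eventually_sequentially)
    \<comment> \<open>Error event: the killing rates from time \<open>m\<close> on add up to more
      than \<gamma>.\<close>
    define P3 where "P3 m \<omega> \<longleftrightarrow> (\<exists>N. \<gamma> < (\<Sum>i=m..<m + N. kill_rate (X i \<omega>)))" for m \<omega>
    have [measurable]: "Measurable.pred M (P3 m)" for m unfolding P3_def by measurable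
    have "\<forall>\<^sub>F m in sequentially. prob {\<omega> \<in> space M. P3 m \<omega>} \<le> \<gamma>"
    proof (rule prob_le_eventually)
      show "P3 m \<omega>" if "P3 (Suc m) \<omega>" for m \<omega>
      proof -
        obtain N where "\<gamma> < (\<Sum>i=Suc m..<Suc m + N. kill_rate (X i \<omega>))"
          using \<open>P3 (Suc m) \<omega>\<close> by (auto simp: P3_def)
        also have "\<dots> \<le> (\<Sum>i=m..<m + Suc N. kill_rate (X i \<omega>))"
          using kill_rate_pos by (intro sum_mono2) (auto simp: less_imp_le)
        finally show ?thesis unfolding P3_def by blast
      qed
      show "AE \<omega> in M. \<exists>m. \<not> P3 m \<omega>"
        using summ
      proof eventually_elim
        case (elim \<omega>)
        from summable_partial_sum_bound[OF elim \<gamma>] obtain m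
          where "\<And>n n'. m \<le> n \<Longrightarrow> norm (\<Sum>i=n..n'. kill_rate (X i \<omega>)) < \<gamma>" by blast
        then have m: "\<bar>\<Sum>i=m..n'. kill_rate (X i \<omega>)\<bar> < \<gamma>" for n' by simp
        have "(\<Sum>i=m..<m + N. kill_rate (X i \<omega>)) \<le> \<gamma>" for N
        proof (cases N)
          case (Suc N')
          then have "{m..<m + N} = {m..m + N'}" by auto
          then show ?thesis using m[of "m + N'"] by simp
        qed (use \<gamma> in simp)
        then show ?case by (auto simp: P3_def not_less)
      qed
    qed (measurable, rule \<gamma>)
    then obtain m0 where m0: "\<And>m. m0 \<le> m \<Longrightarrow> prob {\<omega> \<in> space M. P3 m \<omega>} \<le> \<gamma>"
      by (auto simp: eventually_sequentially)
    define P4 where "P4 N \<omega> \<longleftrightarrow> \<not> (\<forall>n\<ge>N. hit (X n \<omega>) \<le> real n powr (- 1/4))" for N \<omega>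
    have [measurable]: "Measurable.pred M (P4 N)" for N unfolding P4_def by measurable
    have P4: "\<forall>\<^sub>F N in sequentially. prob {\<omega> \<in> space M. P4 N \<omega>} \<le> \<gamma>"
    proof (rule prob_le_eventually)
      show "AE \<omega> in M. \<exists>N. \<not> P4 N \<omega>"
        using decay by eventually_elim (simp add: P4_def eventually_sequentially)
      show "P4 N \<omega>" if "P4 (Suc N) \<omega>" for N \<omega>
        using that unfolding P4_def by (meson Suc_leD)
    qed (measurable, rule \<gamma>)
    \<comment> \<open>\<open>k\<close> puts the new cut time at or after \<open>k\<close>,
      \<open>J\<close> makes \<open>F\<close> an event of the path up to \<open>m\<close>, and
      \<open>m0\<close> controls the killing.\<close>
    define m where "m = max k (max J m0)"
    \<comment> \<open>Error event: the walk is already deep by time \<open>m\<close>. Off it,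
      \<theta> bounds the minimum of \<open>hit\<close> from below.\<close>
    define P5 where "P5 n \<omega> \<longleftrightarrow> (\<exists>i\<le>m. hit (X i \<omega>) < 1 / real (Suc n))" for n \<omega>
    have [measurable]: "Measurable.pred M (P5 n)" for n unfolding P5_def by measurable
    have "\<forall>\<^sub>F n in sequentially. prob {\<omega> \<in> space M. P5 n \<omega>} \<le> \<gamma>"
    proof (rule prob_le_eventually)
      have "\<exists>n. \<not> P5 n \<omega>" for \<omega>
      proof -
        have lim: "(\<lambda>n. 1 / real (Suc n)) \<longlonglongrightarrow> 0"
          using LIMSEQ_inverse_real_of_nat by (simp add: inverse_eq_divide)
        have "\<forall>\<^sub>F n in sequentially. \<forall>i\<in>{..m}. 1 / real (Suc n) < hit (X i \<omega>)"
          by (intro eventually_ball_finite ballI order_tendstoD(2)[OF lim] hit_pos finite_atMost)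
        then obtain n where "\<forall>i\<in>{..m}. 1 / real (Suc n) < hit (X i \<omega>)"
          by (auto simp only: eventually_sequentially)
        then have "\<not> P5 n \<omega>" unfolding P5_def by (meson atMost_iff less_asym)
        then show ?thesis ..
      qed
      then show "AE \<omega> in M. \<exists>n. \<not> P5 n \<omega>" by simp
      show "P5 n \<omega>" if "P5 (Suc n) \<omega>" for n \<omega>
      proof -
        have "1 / real (Suc (Suc n)) \<le> 1 / real (Suc n)" by (intro divide_left_mono) auto
        then show ?thesis using that unfolding P5_def by (meson order.strict_trans2)
      qed
    qed (measurable, rule \<gamma>)
    then obtain q where q: "prob {\<omega> \<in> space M. P5 q \<omega>} \<le> \<gamma>"
      by (auto simp: eventually_sequentially)
    define \<theta> where "\<theta> = 1 / real (Suc q)"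
    define F where "F zs \<longleftrightarrow> zs \<noteq> [] \<and> (\<forall>z\<in>set zs. \<theta> \<le> hit z) \<and>
       (\<forall>n\<in>{k..R}. \<exists>i\<le>n. \<exists>j\<le>J. n < j \<and> zs ! i = zs ! j)" for zs
    have F_iff: "F (walk_path m \<omega>) \<longleftrightarrow> \<not> P5 q \<omega> \<and> (\<forall>n\<in>{k..R}. rep J n \<omega>)" for \<omega>
    proof -
      have "(\<forall>z\<in>set (walk_path m \<omega>). \<theta> \<le> hit z) \<longleftrightarrow> \<not> P5 q \<omega>"
        by (auto simp: P5_def \<theta>_def walk_path_def not_less less_Suc_eq_le simp del: upt_Suc)
      moreover have "(\<forall>n\<in>{k..R}. \<exists>i\<le>n. \<exists>j\<le>J. n < j \<and> walk_path m \<omega> ! i = walk_path m \<omega> ! j) \<longleftrightarrow>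
          (\<forall>n\<in>{k..R}. rep J n \<omega>)"
        unfolding rep_def by (intro ball_cong ex_cong1 conj_cong refl) (simp add: nth_walk_path m_def)
      moreover have "walk_path m \<omega> \<noteq> []" by (simp add: walk_path_def)
      ultimately show ?thesis unfolding F_def by blast
    qed
    have [measurable]: "Measurable.pred M (\<lambda>\<omega>. F (walk_path m \<omega>))"
      unfolding F_iff by measurable
    have "filterlim (\<lambda>N. 1 / 4 * ln (real N)) at_top sequentially"
      by (rule filterlim_tendsto_pos_mult_at_top[OF tendsto_const _
            filterlim_compose[OF ln_at_top filterlim_real_sequentially]]) simp
    then have lnN: "filterlim (\<lambda>N. ln (real N) / 4) at_top sequentially"
      by simp
    \<comment> \<open>\<open>N\<close> is chosen last, so that \<open>K\<close> outweighs the fixed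
      initial depth given by \<theta>.\<close>
    have "\<forall>\<^sub>F N in sequentially. prob {\<omega> \<in> space M. P4 N \<omega>} \<le> \<gamma> \<and> 2 \<le> ln (real N) / 4 \<and>
        (\<bar>ln \<theta>\<bar> + 2) / \<gamma> \<le> ln (real N) / 4 \<and> 2 \<le> N"
      by (intro eventually_conj P4 eventually_ge_at_top lnN[unfolded filterlim_at_top, rule_format])
    then obtain N where N: "prob {\<omega> \<in> space M. P4 N \<omega>} \<le> \<gamma>" "2 \<le> ln (real N) / 4"
        "(\<bar>ln \<theta>\<bar> + 2) / \<gamma> \<le> ln (real N) / 4" "2 \<le> N"
      by (auto simp: eventually_sequentially)
    define K where "K = ln (real N) / 4"
    have expK: "real n powr (- 1/4) \<le> exp (- K)" if "N \<le> n" for n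
    proof -
      have "real n powr (- 1/4) \<le> real N powr (- 1/4)"
        using that N(4) by (intro powr_mono2') auto
      also have "\<dots> = exp (- K)" using N(4) by (simp add: powr_def K_def)
      finally show ?thesis .
    qed
    have decayed: "hit (X n \<omega>) \<le> exp (- K)" if "\<not> P4 N \<omega>" "N \<le> n" for n \<omega>
      using that expK[of n] unfolding P4_def by (meson order.trans)
    let ?F = "{\<omega> \<in> space M. F (walk_path m \<omega>)}"
    let ?small = "{\<omega> \<in> space M. F (walk_path m \<omega>) \<and> hit (X (m + N) \<omega>) \<le> exp (- K)}"
    let ?sep = "{\<omega> \<in> space M. F (walk_path m \<omega>) \<and> separated (exp (- K)) m N \<omega>}"
    have "K * prob ?small \<le> (2 + 7 * K) * (prob ?sep + \<gamma>
         + prob {\<omega> \<in> space M. \<gamma> < (\<Sum>i=m..<m + N. kill_rate (X i \<omega>))}) + \<bar>ln \<theta>\<bar> + 2"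
      using N(4) \<gamma> by (intro separation_bound) (auto simp: K_def \<theta>_def F_def)
    also have "\<dots> \<le> (2 + 7 * K) * (2 * \<gamma> + \<gamma> + \<gamma>) + \<gamma> * K"
    proof -
      \<comment> \<open>With the decay in force, the separating level gives a cut time after
        \<open>m\<close>, while \<open>F\<close> excludes cut times in \<open>{k..R}\<close>; this
        is \<open>P1 R\<close>.\<close>
      have "prob ?sep \<le> prob ({\<omega> \<in> space M. P1 R \<omega>} \<union> {\<omega> \<in> space M. P4 N \<omega>})"
      proof (rule finite_measure_mono)
        show "?sep \<subseteq> {\<omega> \<in> space M. P1 R \<omega>} \<union> {\<omega> \<in> space M. P4 N \<omega>}"
        proof safe
          fix \<omega> assume \<omega>: "F (walk_path m \<omega>)" "separated (exp (- K)) m N \<omega>" "\<not> P4 N \<omega>"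
          from \<omega>(2) obtain n a where na: "m \<le> n" "exp (- K) < a" "\<forall>i\<le>n. a \<le> hit (X i \<omega>)"
            "\<forall>i. n < i \<longrightarrow> i \<le> m + N \<longrightarrow> hit (X i \<omega>) < a" unfolding separated_def by blast
          have "hit (X j \<omega>) < a" if "n < j" for j
            using na(2,4) that decayed[OF \<omega>(3), of j] by (cases "j \<le> m + N") auto
          then have "?cut \<omega> n"
            using na(3) not_cut_time_iff[of "\<lambda>i. X i \<omega>" n] by (metis not_less)
          moreover have "k \<le> n" using na(1) by (simp add: m_def)
          ultimately have "\<not> none \<omega>" unfolding none_def by blast
          moreover have "\<forall>n\<in>{k..R}. \<not> ?cut \<omega> n"
            using \<omega>(1) rep_imp unfolding F_iff by blast
          ultimately show "P1 R \<omega>" by (simp add: P1_def)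
        qed
      qed measurable
      also have "\<dots> \<le> prob {\<omega> \<in> space M. P1 R \<omega>} + prob {\<omega> \<in> space M. P4 N \<omega>}"
        by (rule measure_Un_le) measurable
      finally have "prob ?sep \<le> 2 * \<gamma>" using R N(1) by simp
      moreover have "prob {\<omega> \<in> space M. \<gamma> < (\<Sum>i=m..<m + N. kill_rate (X i \<omega>))} \<le> prob {\<omega> \<in> space M. P3 m \<omega>}"
        by (rule finite_measure_mono) (auto simp: P3_def)
      moreover have "prob {\<omega> \<in> space M. P3 m \<omega>} \<le> \<gamma>" by (rule m0) (simp add: m_def)
      moreover have "\<bar>ln \<theta>\<bar> + 2 \<le> \<gamma> * K"
        using N(3) \<gamma> by (simp add: K_def field_simps)
      moreover have "0 \<le> 2 + 7 * K" using N(2) by (simp add: K_def)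
      ultimately have "(2 + 7 * K) * (prob ?sep + \<gamma> + prob {\<omega> \<in> space M. \<gamma> < (\<Sum>i=m..<m + N. kill_rate (X i \<omega>))})
          \<le> (2 + 7 * K) * (2 * \<gamma> + \<gamma> + \<gamma>)" by (intro mult_left_mono) auto
      with \<open>\<bar>ln \<theta>\<bar> + 2 \<le> \<gamma> * K\<close> show ?thesis by linarith
    qed
    \<comment> \<open>K >= 2 gives 2 + 7 K <= 8 K, and 8 times 4 plus 1 is 33.\<close>
    also have "\<dots> \<le> (8 * K) * (2 * \<gamma> + \<gamma> + \<gamma>) + \<gamma> * K"
      using N(2) \<gamma> by (intro add_right_mono mult_right_mono) (auto simp: K_def)
    also have "\<dots> = K * (33 * \<gamma>)" by simp
    finally have "prob ?small \<le> 33 * \<gamma>"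
      using N(2) by (simp add: K_def)
    moreover have "prob ?F \<le> prob (?small \<union> {\<omega> \<in> space M. P4 N \<omega>})"
      using decayed[of _ "m + N"] by (intro finite_measure_mono) auto
    moreover have "\<dots> \<le> prob ?small + prob {\<omega> \<in> space M. P4 N \<omega>}"
      by (rule measure_Un_le) measurable
    moreover have "prob {\<omega> \<in> space M. none \<omega>} \<le> prob (?F \<union> {\<omega> \<in> space M. P2 J \<omega>} \<union> {\<omega> \<in> space M. P5 q \<omega>})"
    proof (rule finite_measure_mono)
      show "{\<omega> \<in> space M. none \<omega>} \<subseteq> ?F \<union> {\<omega> \<in> space M. P2 J \<omega>} \<union> {\<omega> \<in> space M. P5 q \<omega>}"
        unfolding F_iff by (auto simp: none_def P2_def)
    qed measurable
    moreover have "\<dots> \<le> prob (?F \<union> {\<omega> \<in> space M. P2 J \<omega>}) + prob {\<omega> \<in> space M. P5 q \<omega>}"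
      by (rule measure_Un_le) measurable
    moreover have "prob (?F \<union> {\<omega> \<in> space M. P2 J \<omega>}) \<le> prob ?F + prob {\<omega> \<in> space M. P2 J \<omega>}"
      by (rule measure_Un_le) measurable
    ultimately show ?thesis using J q N(1) by linarith
  qed
  have "prob {\<omega> \<in> space M. none \<omega>} \<le> 0"
  proof (rule field_le_epsilon)
    fix e :: real assume "0 < e"
    then show "prob {\<omega> \<in> space M. none \<omega>} \<le> 0 + e" using bound[of "e / 36"] by simp
  qed
  then show ?thesis by (simp add: none_def measure_le_0_iff)
qed

lemma infinite_cut_times:
  assumes "AE \<omega> in M. summable (\<lambda>n. kill_rate (X n \<omega>))"
    and "AE \<omega> in M. \<forall>\<^sub>F n in sequentially. hit (X n \<omega>) \<le> real n powr (- 1/4)"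
  shows "AE \<omega> in M. infinite {n. cut_time (\<lambda>i. X i \<omega>) n}"
proof -
  have "AE \<omega> in M. \<not> (\<forall>n\<ge>k. \<not> cut_time (\<lambda>i. X i \<omega>) n)" for k
    by (rule AE_I[of _ _ "{\<omega> \<in> space M. \<forall>n\<ge>k. \<not> cut_time (\<lambda>i. X i \<omega>) n}"])
      (auto simp: emeasure_eq_measure prob_no_cut_time_after[OF assms])
  then have "AE \<omega> in M. \<forall>k. \<not> (\<forall>n\<ge>k. \<not> cut_time (\<lambda>i. X i \<omega>) n)"
    by (simp add: AE_all_countable)
  then show ?thesis
    by eventually_elim (unfold infinite_nat_iff_unbounded_le, blast)
qed

end

section \<open>Consequences of the escape rate\<close>

text \<open>Cauchy condensation leads to the terms 1 / (1 + n ln 2)^2. The 1 added to the logarithm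
  avoids a zero denominator at n = 1.\<close>

lemma summable_inverse_n_log_squared: "summable (\<lambda>n. 1 / (real n * (1 + ln (real n))\<^sup>2))"
proof -
  have "summable (\<lambda>n. 1 / ((2::real) ^ n * (1 + ln (2 ^ n))\<^sup>2) * 2 ^ n)"
  proof (rule summable_comparison_test)
    show "\<exists>N. \<forall>n\<ge>N. norm (1 / ((2::real) ^ n * (1 + ln (2 ^ n))\<^sup>2) * 2 ^ n) \<le> (1 / (ln 2)\<^sup>2) * (1 / real n ^ 2)"
    proof (intro exI[of _ 1] allI impI)
      fix n :: nat assume "1 \<le> n"
      then have "(real n * ln 2)\<^sup>2 \<le> (1 + real n * ln 2)\<^sup>2" "0 < (real n * ln 2)\<^sup>2"
        by (auto intro!: power_mono)
      moreover have "1 + real n * ln 2 \<noteq> 0" by (simp add: add_nonneg_eq_0_iff)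
      ultimately have "1 / (1 + real n * ln 2)\<^sup>2 \<le> 1 / (real n * ln 2)\<^sup>2"
        by (intro divide_left_mono mult_pos_pos) auto
      then show "norm (1 / ((2::real) ^ n * (1 + ln (2 ^ n))\<^sup>2) * 2 ^ n) \<le> (1 / (ln 2)\<^sup>2) * (1 / real n ^ 2)"
        by (simp add: ln_realpow power_mult_distrib mult.commute)
    qed
    show "summable (\<lambda>n. (1 / (ln 2)\<^sup>2) * (1 / real n ^ 2))"
      using inverse_power_summable[of 2, where ?'a = real] by (intro summable_mult) (simp add: inverse_eq_divide)
  qed
  then show ?thesis
  proof (subst condensation_test)
    fix m :: nat assume "0 < m"
    then have "1 + ln (real m) \<noteq> 0" "1 + ln (1 + real m) \<noteq> 0"
      by (simp_all add: add_nonneg_eq_0_iff)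
    with \<open>0 < m\<close> show "1 / (real (Suc m) * (1 + ln (real (Suc m)))\<^sup>2) \<le> 1 / (real m * (1 + ln (real m))\<^sup>2)"
      by (intro divide_left_mono mult_mono power_mono mult_pos_pos) (auto simp: add_pos_nonneg)
  qed (auto simp: mult.commute)
qed

context conductance_network
begin

text \<open>Moving the base point from x 0 to \<open>root\<close> costs a constant, absorbed by half
  of the growth; another factor 2 comes from 1 + ln n <= 2 ln n. Once ln n >= 1, the power
  \<open>r\<close> of the logarithm is at least the first power.\<close>

lemma rate_of_escape:
  assumes "liminf (\<lambda>n. ereal (real (graph_dist c (x 0) (x n)) / (sqrt (real n) * ln (real n) powr r))) > 0"
    and "1 \<le> r"
  obtains e where "0 < e" "\<forall>\<^sub>F n in sequentially. e * (sqrt (real n) * (1 + ln (real n))) \<le> s (x n)"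
proof -
  obtain \<epsilon> where \<epsilon>: "0 < ereal \<epsilon>"
      "ereal \<epsilon> < liminf (\<lambda>n. ereal (real (graph_dist c (x 0) (x n)) / (sqrt (real n) * ln (real n) powr r)))"
    using ereal_dense2[OF assms(1)] by blast
  have e0: "0 < \<epsilon>" using \<epsilon>(1) by simp
  define D where "D = real (graph_dist c (x 0) root)"
  have "\<forall>\<^sub>F n in sequentially. ereal \<epsilon> < ereal (real (graph_dist c (x 0) (x n)) / (sqrt (real n) * ln (real n) powr r))"
    using \<epsilon>(2) by (rule less_LiminfD)
  moreover have "\<forall>\<^sub>F n in sequentially. 1 \<le> ln (real n)"
    using filterlim_compose[OF ln_at_top filterlim_real_sequentially] by (simp add: filterlim_at_top)
  moreover have "\<forall>\<^sub>F n in sequentially. 2 * D / \<epsilon> \<le> sqrt (real n)"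
    using filterlim_compose[OF sqrt_at_top filterlim_real_sequentially] by (simp add: filterlim_at_top)
  ultimately have "\<forall>\<^sub>F n in sequentially. \<epsilon> / 4 * (sqrt (real n) * (1 + ln (real n))) \<le> s (x n)"
    using eventually_gt_at_top[of 0]
  proof eventually_elim
    case (elim n)
    let ?t = "sqrt (real n) * ln (real n)"
    have "ln (real n) powr 1 \<le> ln (real n) powr r"
      using elim(2) assms(2) by (rule powr_mono[rotated])
    then have "\<epsilon> * ?t \<le> \<epsilon> * (sqrt (real n) * ln (real n) powr r)"
      using e0 elim by (intro mult_left_mono) auto
    also have "\<dots> \<le> real (graph_dist c (x 0) (x n))"
    proof -
      have "0 < ln (real n) powr r" using elim(2) by (subst powr_gt_zero) linarith
      then have "0 < sqrt (real n) * ln (real n) powr r" using elim by simp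
      then show ?thesis using elim(1) by (simp add: pos_less_divide_eq)
    qed
    also have "\<dots> \<le> D + s (x n)"
      using graph_dist_triangle[of "x 0" "x n" root] by (simp add: D_def s_def)
    finally have *: "\<epsilon> * ?t \<le> D + s (x n)" .
    have "sqrt (real n) * 1 \<le> ?t"
      using elim(2) by (intro mult_left_mono) auto
    with elim(3) have "2 * D / \<epsilon> \<le> ?t"
      by linarith
    then have "D \<le> \<epsilon> / 2 * ?t"
      using e0 by (simp add: field_simps)
    with * have "\<epsilon> / 2 * ?t \<le> s (x n)" by simp
    moreover have "sqrt (real n) * (1 + ln (real n)) \<le> 2 * ?t"
      using elim mult_left_mono[of 1 "ln (real n)" "sqrt (real n)"] by (simp add: algebra_simps)
    then have "\<epsilon> / 4 * (sqrt (real n) * (1 + ln (real n))) \<le> \<epsilon> / 4 * (2 * ?t)"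
      using e0 by (intro mult_left_mono) auto
    ultimately show ?case by simp
  qed
  then show ?thesis using that[of "\<epsilon> / 4"] e0 by simp
qed

lemma summable_kill_rate:
  assumes "0 < e" "\<forall>\<^sub>F n in sequentially. e * (sqrt (real n) * (1 + ln (real n))) \<le> s (x n)"
  shows "summable (\<lambda>n. kill_rate (x n))"
proof (rule summable_comparison_test_ev)
  show "\<forall>\<^sub>F n in sequentially. norm (kill_rate (x n)) \<le> 6 / e\<^sup>2 * (1 / (real n * (1 + ln (real n))\<^sup>2))"
    using assms(2) eventually_gt_at_top[of 0]
  proof eventually_elim
    case (elim n)
    have pos: "0 < e * (sqrt (real n) * (1 + ln (real n)))"
      using assms(1) elim by (auto simp: add_pos_nonneg)
    have "6 / (s (x n))\<^sup>2 \<le> 6 / (e * (sqrt (real n) * (1 + ln (real n))))\<^sup>2"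
      using elim pos s_ge_1[of "x n"] by (intro divide_left_mono power_mono mult_pos_pos) auto
    then show ?case
      using kill_rate_pos[of "x n"] by (simp add: kill_rate_def power_mult_distrib)
  qed
qed (intro summable_mult summable_inverse_n_log_squared)

text \<open>\<open>hit_decay\<close> gives order n^(-1/2); half of the exponent is spent on
  absorbing the constant.\<close>

lemma eventually_hit_le:
  assumes "0 < e" "\<forall>\<^sub>F n in sequentially. e * (sqrt (real n) * (1 + ln (real n))) \<le> s (x n)"
  shows "\<forall>\<^sub>F n in sequentially. hit (x n) \<le> real n powr (- 1/4)"
proof -
  define B where "B = sqrt (5 * cond_tot c root / \<delta>)"
  have B: "0 \<le> B" using cond_tot_pos[of root] \<delta>_pos by (simp add: B_def)
  have "filterlim (\<lambda>n. real n powr (1/4)) at_top sequentially"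
    by (intro filterlim_compose[OF real_powr_at_top filterlim_real_sequentially]) simp
  then have "\<forall>\<^sub>F n in sequentially. B / e \<le> real n powr (1/4)"
    by (simp add: filterlim_at_top)
  with assms(2) show ?thesis
    using eventually_gt_at_top[of 0]
  proof eventually_elim
    case (elim n)
    have n: "sqrt (real n) = real n powr (1/4) * real n powr (1/4)" "0 < real n powr (1/4)"
      using elim by (auto simp: powr_half_sqrt[symmetric] powr_add[symmetric])
    have "e * sqrt (real n) \<le> e * (sqrt (real n) * (1 + ln (real n)))"
      using elim assms(1) by (intro mult_left_mono) (auto simp: algebra_simps)
    then have s: "e * sqrt (real n) \<le> s (x n)" using elim by linarith
    have "hit (x n) \<le> B / s (x n)" using hit_decay by (simp add: B_def)
    also have "\<dots> \<le> B / (e * sqrt (real n))"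
      using s B assms(1) elim s_ge_1[of "x n"] by (intro divide_left_mono mult_pos_pos) auto
    also have "\<dots> = (B / e) / sqrt (real n)" by simp
    also have "\<dots> \<le> real n powr (1/4) / sqrt (real n)"
      using elim by (intro divide_right_mono) auto
    also have "\<dots> = real n powr (- 1/4)"
      using n by (simp add: powr_minus_divide)
    finally show ?case .
  qed
qed

end

theorem theorem1p4:
  fixes c :: "'v \<Rightarrow> 'v \<Rightarrow> real"
    and M :: "'a measure"
    and X :: "nat \<Rightarrow> 'a \<Rightarrow> 'v"
    and r :: real
  assumes "network c"
    and "locally_finite c"
    and "connected_net c"
    and "\<exists>\<delta>>0. \<forall>v. cond_tot c v \<ge> \<delta>"
    and "random_walk M c X"
    and "r > 3/2"
    and "AE \<omega> in M. liminf (\<lambda>n. ereal (real (graph_dist c (X 0 \<omega>) (X n \<omega>))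
                                    / (sqrt (real n) * ln (real n) powr r))) > 0"
  shows "AE \<omega> in M. infinite {n. cut_time (\<lambda>i. X i \<omega>) n}"
proof -
  obtain \<delta> where \<delta>: "0 < \<delta>" "\<forall>v. \<delta> \<le> cond_tot c v" using assms(4) by blast
  \<comment> \<open>\<open>undefined\<close> serves as an arbitrary root, unrelated to the start of
    the walk.\<close>
  interpret network_walk c undefined \<delta> M X
    by unfold_locales (use assms(1,2,3,5) \<delta> in auto)
  have escape: "AE \<omega> in M. \<exists>e>0. \<forall>\<^sub>F n in sequentially. e * (sqrt (real n) * (1 + ln (real n))) \<le> s (X n \<omega>)"
    using assms(7)
  proof eventually_elim
    case (elim \<omega>)
    have "1 \<le> r" using assms(6) by simp
    obtain e where "0 < e" "\<forall>\<^sub>F n in sequentially. e * (sqrt (real n) * (1 + ln (real n))) \<le> s (X n \<omega>)"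
      by (rule rate_of_escape[where x = "\<lambda>n. X n \<omega>", OF elim \<open>1 \<le> r\<close>])
    then show ?case by (intro exI conjI)
  qed
  show ?thesis
  proof (rule infinite_cut_times)
    show "AE \<omega> in M. summable (\<lambda>n. kill_rate (X n \<omega>))"
      using escape
    proof eventually_elim
      case (elim \<omega>)
      then obtain e where "0 < e" "\<forall>\<^sub>F n in sequentially. e * (sqrt (real n) * (1 + ln (real n))) \<le> s (X n \<omega>)"
        by blast
      then show ?case by (rule summable_kill_rate[where x = "\<lambda>n. X n \<omega>"])
    qed
    show "AE \<omega> in M. \<forall>\<^sub>F n in sequentially. hit (X n \<omega>) \<le> real n powr (- 1/4)"
      using escape
    proof eventually_elim
      case (elim \<omega>)
      then obtain e where "0 < e" "\<forall>\<^sub>F n in sequentially. e * (sqrt (real n) * (1 + ln (real n))) \<le> s (X n \<omega>)"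
        by blast
      then show ?case by (rule eventually_hit_le[where x = "\<lambda>n. X n \<omega>"])
    qed
  qed
qed

end
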